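(* Let $(S)$ be a connected symmetric Hopf SDSE (with $F_i(0,\ldots,0)=1$ for all $i$). Then $(S)$ is $2$-multicyclic or quasi-complete.
   Context: $K$ is a field of characteristic zero and $I$ a finite non-empty set. $\mathcal{H}_I$ is the (Connes-Kreimer) polynomial algebra generated by the set of (isomorphism classes of non-planar) rooted trees whose vertices are decorated by elements of $I$; monomials are forests; it is graded by the number of vertices, and $\widehat{\mathcal H_I}=\prod_n\mathcal H_I(n)$ is its completion. The coproduct is the algebra morphism with $\Delta(t)=t\otimes1+1\otimes t+\sum_cP^c(t)\otimes R^c(t)$ for each tree $t$, where $c$ runs over non-empty sets of edges of $t$ such that every path from the root to a leaf meets at most one edge of $c$; after deleting the edges of $c$, $R^c(t)$ is the component containing the root and $P^c(t)$ is the product of the other components. This makes $\mathcal H_I$ a Hopf algebra. $B_i^+$ is the linear (continuous) operator sending a forest to the tree obtained by grafting its trees on a common root decorated by $i$. The SDSE $(S)$ associated to non-constant series $(F_i)_{i\in I}$, $F_i\in K[[h_j,j\in I]]$, is the system $X_i=B_i^+(F_i(X_j,j\in I))$, $i\in I$; it has a unique solution $(X_i)_{i\in I}\in\widehat{\mathcal H_I}^{\,I}$. $X_i(n)$ is the homogeneous component of degree $n$ of $X_i$, and $\mathcal H_{(S)}$ is the subalgebra of $\mathcal H_I$ generated by all the $X_i(n)$. $(S)$ is Hopf if $\mathcal H_{(S)}$ is a Hopf subalgebra of $\mathcal H_I$. The graph $G_{(S)}$ has vertex set $I$ and an oriented edge $i\to j$ iff $\partial F_i/\partial h_j\ne0$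 (loops allowed). $(S)$ is connected if $G_{(S)}$ is connected (as an undirected graph). $(S)$ is symmetric if $G_{(S)}$ has no loops and, for $i\ne j$, there is an edge from $i$ to $j$ iff there is an edge from $j$ to $i$. A change of variables replaces $(F_i(h_j,j\in I))_{i\in I}$ by $(F_i(\lambda_jh_j,j\in I))_{i\in I}$ with all $\lambda_j\in K-\{0\}$. $(S)$ is $2$-multicyclic if there is a partition $I=I_1\cup I_2$ into two non-empty sets such that, up to a change of variables, $F_x=1+\sum_{y\in I_2}h_y$ for all $x\in I_1$ and $F_x=1+\sum_{y\in I_1}h_y$ for all $x\in I_2$. $(S)$ is quasi-complete if there are $M\ge2$ and a partition $I=I_1\cup\cdots\cup I_M$ into non-empty sets such that, up to a change of variables, for all $1\le i\le M$ and all $x\in I_i$, $F_x=\prod_{j\ne i}\big(1-\sum_{y\in I_j}h_y\big)^{-1}$. *)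

theory Defs
  imports
    Complex_Main
    "HOL-Library.Multiset"
    "HOL-Library.Sublist"
    "HOL-Library.Disjoint_Sets"
    "HOL-Library.Product_Plus"
    "HOL-Library.Poly_Mapping"
begin

section \<open>Formal power series in several variables\<close>

text \<open>
  A series in variables indexed by \<^typ>\<open>'a\<close> is a family of coefficients indexed by the monomials,
  that is, by the finite multisets of variables.  The same type serves for \<open>K[[h\<^sub>j, j \<in> I]]\<close>
  (with \<^typ>\<open>'a\<close> the index type \<open>I\<close>) and for the completion of the Connes-Kreimer algebra (with
  \<^typ>\<open>'a\<close> the type of decorated rooted trees: there are finitely many forests of each
  degree, so the product of the homogeneous components consists of all families of
  coefficients indexed by forests).
\<close>

typedef ('a, 'k) mps = "UNIV :: ('a multiset \<Rightarrow> 'k) set"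
  morphisms coeff Abs_mps by simp

setup_lifting type_definition_mps

lemma mps_eqI: "(\<And>M. coeff f M = coeff g M) \<Longrightarrow> f = g"
  by (simp add: coeff_inject[symmetric] fun_eq_iff)

lemma coeff_Abs_mps [simp]: "coeff (Abs_mps f) = f"
  by (simp add: Abs_mps_inverse)

lemma finite_msubsets: "finite {N. N \<subseteq># (M :: 'a multiset)}"
proof (induction M)
  case empty
  then show ?case by simp
next
  case (add x M)
  have "{N. N \<subseteq># add_mset x M} \<subseteq> {N. N \<subseteq># M} \<union> add_mset x ` {N. N \<subseteq># M}"
  proof
    fix N assume "N \<in> {N. N \<subseteq># add_mset x M}"
    hence N: "N \<subseteq># add_mset x M" by simp
    show "N \<in> {N. N \<subseteq># M} \<union> add_mset x ` {N. N \<subseteq># M}"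
    proof (cases "x \<in># N")
      case True
      then obtain N' where "N = add_mset x N'" by (metis insert_DiffM)
      with N show ?thesis by auto
    next
      case False
      with N have "N \<subseteq># M" by (metis count_add_mset count_eq_zero_iff le0 mset_subset_eqI mset_subset_eq_count)
      thus ?thesis by blast
    qed
  qed
  with add show ?case by (meson finite_UnI finite_imageI finite_subset)
qed

lemma finite_msplits: "finite {(N, L). N + L = (M :: 'a multiset)}"
proof (rule finite_subset)
  show "{(N, L). N + L = M} \<subseteq> {N. N \<subseteq># M} \<times> {N. N \<subseteq># M}" by auto
  show "finite ({N. N \<subseteq># M} \<times> {N. N \<subseteq># M})" using finite_msubsets by blast
qed

instantiation mps :: (type, comm_ring_1) comm_ring_1
begin

lift_definition zero_mps :: "('a, 'b) mps" is "\<lambda>_. 0" .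

lift_definition one_mps :: "('a, 'b) mps" is "\<lambda>M. if M = {#} then 1 else 0" .

lift_definition plus_mps :: "('a, 'b) mps \<Rightarrow> ('a, 'b) mps \<Rightarrow> ('a, 'b) mps"
  is "\<lambda>f g M. f M + g M" .

lift_definition minus_mps :: "('a, 'b) mps \<Rightarrow> ('a, 'b) mps \<Rightarrow> ('a, 'b) mps"
  is "\<lambda>f g M. f M - g M" .

lift_definition uminus_mps :: "('a, 'b) mps \<Rightarrow> ('a, 'b) mps"
  is "\<lambda>f M. - f M" .

lift_definition times_mps :: "('a, 'b) mps \<Rightarrow> ('a, 'b) mps \<Rightarrow> ('a, 'b) mps"
  is "\<lambda>f g M. \<Sum>(N, L) \<in> {(N, L). N + L = M}. f N * g L" .

instance
proof
  fix a b c :: "('a, 'b) mps"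
  show "a + b + c = a + (b + c)" by transfer (simp add: fun_eq_iff ac_simps)
  show "a + b = b + a" by transfer (simp add: fun_eq_iff ac_simps)
  show "0 + a = a" by transfer simp
  show "- a + a = 0" by transfer simp
  show "a - b = a + - b" by transfer simp
  show "(0 :: ('a, 'b) mps) \<noteq> 1" by transfer (auto simp: fun_eq_iff)
  show "(a + b) * c = a * c + b * c"
    by transfer (simp add: fun_eq_iff case_prod_unfold distrib_right sum.distrib)
  show "a * b = b * a"
  proof (rule mps_eqI)
    fix M
    show "coeff (a * b) M = coeff (b * a) M"
      unfolding times_mps.rep_eq
      by (rule sum.reindex_bij_witness[of _ prod.swap prod.swap])
        (auto simp: add.commute mult.commute)
  qed
  show "1 * a = a"
  proof (rule mps_eqI)
    fix M
    have "coeff (1 * a) M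
        = (\<Sum>p \<in> {(N, L). N + L = M}. if p = ({#}, M) then coeff a M else 0)"
      unfolding times_mps.rep_eq one_mps.rep_eq by (rule sum.cong) (auto split: if_splits)
    also have "\<dots> = coeff a M"
      by (simp add: finite_msplits)
    finally show "coeff (1 * a) M = coeff a M" .
  qed
  show "a * b * c = a * (b * c)"
  proof (rule mps_eqI)
    fix M
    have "coeff (a * b * c) M = (\<Sum>p \<in> {(N, L). N + L = M}. \<Sum>q \<in> {(N, L). N + L = fst p}.
        coeff a (fst q) * coeff b (snd q) * coeff c (snd p))"
      unfolding times_mps.rep_eq by (simp add: case_prod_unfold sum_distrib_right)
    also have "\<dots> = (\<Sum>(p, q) \<in> (SIGMA p : {(N, L). N + L = M}. {(N, L). N + L = fst p}).
        coeff a (fst q) * coeff b (snd q) * coeff c (snd p))"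
      by (rule sum.Sigma) (use finite_msplits in auto)
    also have "\<dots> = (\<Sum>(p, q) \<in> (SIGMA p : {(N, L). N + L = M}. {(N, L). N + L = snd p}).
        coeff a (fst p) * (coeff b (fst q) * coeff c (snd q)))"
      by (rule sum.reindex_bij_witness[of _
            "\<lambda>(p, q). ((fst p + fst q, snd q), (fst p, fst q))"
            "\<lambda>(p, q). ((fst q, snd q + snd p), (snd q, snd p))"])
        (auto simp: ac_simps)
    also have "\<dots> = (\<Sum>p \<in> {(N, L). N + L = M}. \<Sum>q \<in> {(N, L). N + L = snd p}.
        coeff a (fst p) * (coeff b (fst q) * coeff c (snd q)))"
      by (rule sum.Sigma[symmetric]) (use finite_msplits in auto)
    also have "\<dots> = coeff (a * (b * c)) M"
      unfolding times_mps.rep_eq by (simp add: case_prod_unfold sum_distrib_left)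
    finally show "coeff (a * b * c) M = coeff (a * (b * c)) M" .
  qed
qed

end

definition mps_const :: "'k \<Rightarrow> ('a, 'k :: comm_ring_1) mps" where
  "mps_const c = Abs_mps (\<lambda>M. if M = {#} then c else 0)"

definition mps_var :: "'a \<Rightarrow> ('a, 'k :: comm_ring_1) mps" where
  "mps_var j = Abs_mps (\<lambda>M. if M = {#j#} then 1 else 0)"

definition mps_deriv :: "'a \<Rightarrow> ('a, 'k :: comm_ring_1) mps \<Rightarrow> ('a, 'k) mps" where
  "mps_deriv j f = Abs_mps (\<lambda>M. of_nat (count M j + 1) * coeff f (add_mset j M))"

text \<open>Meaningful for invertible series only; see \<open>mps_inverse_right\<close>.\<close>

definition mps_inverse :: "('a, 'k :: comm_ring_1) mps \<Rightarrow> ('a, 'k) mps" where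
  "mps_inverse f = (THE g. f * g = 1)"

text \<open>
  Substitution \<open>f(X\<^sub>j, j \<in> I)\<close>, computed coefficientwise.  Only used for finitely many variables
  and series \<open>X\<^sub>j\<close> without constant term; then, for each fixed \<open>M\<close>, only finitely many
  multi-indices contribute.
\<close>

definition mps_subst :: "('a, 'k :: comm_ring_1) mps \<Rightarrow> ('a \<Rightarrow> ('b, 'k) mps) \<Rightarrow> ('b, 'k) mps" where
  "mps_subst f X =
     Abs_mps (\<lambda>M. Sum_any (\<lambda>\<alpha>. coeff f \<alpha> * coeff (\<Prod>j \<in># \<alpha>. X j) M))"

lemma coeff_mult:
  "coeff (f * g) M = (\<Sum>(N, L) \<in> {(N, L). N + L = M}. coeff f N * coeff g L)"
  by (simp add: times_mps.rep_eq)

lemma coeff_sum: "coeff (\<Sum>x \<in> A. f x) M = (\<Sum>x \<in> A. coeff (f x) M)"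
  by (induction A rule: infinite_finite_induct) (auto simp: zero_mps.rep_eq plus_mps.rep_eq)

lemma coeff_mult_size_less:
  assumes "\<And>N. size N < m \<Longrightarrow> coeff f N = 0" "\<And>N. size N < n \<Longrightarrow> coeff g N = 0"
    and "size M < m + n"
  shows "coeff (f * g) M = 0"
  unfolding coeff_mult
proof (rule sum.neutral, clarify)
  fix N L :: "'a multiset" assume "M = N + L"
  hence "size N < m \<or> size L < n" using assms(3) by auto
  thus "coeff f N * coeff g L = 0" using assms(1,2) by auto
qed

lemma coeff_power_size_less:
  assumes "coeff f {#} = 0" "size M < n"
  shows "coeff (f ^ n) M = 0"
  using assms(2)
proof (induction n arbitrary: M)
  case (Suc n)
  show ?case unfolding power_Suc
    by (rule coeff_mult_size_less[of 1 _ n]) (use Suc assms(1) in auto)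
qed simp

lemma mps_inverse_right:
  fixes f :: "('a, 'k :: comm_ring_1) mps"
  assumes "coeff f {#} = 1"
  shows "f * mps_inverse f = 1"
proof -
  define u where "u = 1 - f"
  have u0: "coeff u {#} = 0" by (simp add: u_def minus_mps.rep_eq one_mps.rep_eq assms)
  define g where "g = Abs_mps (\<lambda>M. \<Sum>n \<le> size M. coeff (u ^ n) M)"
  have g: "coeff g N = coeff (\<Sum>n \<le> m. u ^ n) N" if "size N \<le> m" for N m
    unfolding g_def coeff_Abs_mps coeff_sum
    by (rule sum.mono_neutral_left) (use that coeff_power_size_less[OF u0] in auto)
  have "f * g = 1"
  proof (rule mps_eqI)
    fix M :: "'a multiset"
    let ?s = "\<Sum>n \<le> size M. u ^ n"
    have "coeff (f * g) M = coeff (f * ?s) M"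
      unfolding coeff_mult by (rule sum.cong) (auto simp: g[of _ "size M"])
    also have "f * ?s = 1 - u ^ Suc (size M)"
      using sum_gp_basic[of u "size M"] by (simp add: u_def)
    also have "coeff \<dots> M = coeff 1 M"
      using coeff_power_size_less[OF u0, of M "Suc (size M)"] by (simp add: minus_mps.rep_eq)
    finally show "coeff (f * g) M = coeff 1 M" .
  qed
  moreover have "h = g" if "f * h = 1" for h
  proof -
    have "h = h * (f * g)" using \<open>f * g = 1\<close> by simp
    also have "\<dots> = (f * h) * g" by (simp add: ac_simps)
    finally show ?thesis using that by simp
  qed
  ultimately have "\<exists>!g. f * g = 1" by blast
  thus ?thesis unfolding mps_inverse_def by (rule theI')
qed


section \<open>Decorated rooted trees and admissible cuts\<close>

datatype 'i rtree = RNode 'i "'i rtree multiset"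

type_synonym 'i forest = "'i rtree multiset"

text \<open>
  Identical subtrees of a non-planar tree cannot be told apart, so cuts are taken on a
  planar representative, in which a vertex is addressed by the list of child indices leading
  to it from the root.
\<close>

datatype 'i ptree = PNode 'i "'i ptree list"

primrec forget_planar :: "'i ptree \<Rightarrow> 'i rtree" where
  "forget_planar (PNode i ps) = RNode i (mset (map forget_planar ps))"

lemma ex_planar: "\<exists>p. forget_planar p = t"
proof (induction t)
  case (RNode i f)
  then obtain r where r: "\<And>t. t \<in># f \<Longrightarrow> forget_planar (r t) = t" by metis
  obtain ts where ts: "mset ts = f" using ex_mset by blast
  have "map forget_planar (map r ts) = ts"
    using r ts by (auto intro!: map_idI)
  hence "forget_planar (PNode i (map r ts)) = RNode i f" using ts by (metis forget_planar.simps)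
  thus ?case by blast
qed

definition planar_rep :: "'i rtree \<Rightarrow> 'i ptree" where
  "planar_rep t = (SOME p. forget_planar p = t)"

lemma forget_planar_rep [simp]: "forget_planar (planar_rep t) = t"
  unfolding planar_rep_def using ex_planar by (rule someI_ex)

fun subtree_at :: "'i ptree \<Rightarrow> nat list \<Rightarrow> 'i ptree" where
  "subtree_at p [] = p"
| "subtree_at (PNode i ps) (k # v) = subtree_at (ps ! k) v"

primrec vertices :: "'i ptree \<Rightarrow> nat list set" where
  "vertices (PNode i ps) = insert [] (\<Union>k < length ps. (#) k ` (map vertices ps ! k))"

text \<open>Every edge is represented by its lower endpoint.\<close>

definition edges :: "'i ptree \<Rightarrow> nat list set" where
  "edges p = vertices p - {[]}"

definition leaves :: "'i ptree \<Rightarrow> nat list set" where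
  "leaves p = {v \<in> vertices p. \<not> (\<exists>w \<in> vertices p. strict_prefix v w)}"

text \<open>The edges on the path from the root to \<open>l\<close> are the edges whose address is a prefix of \<open>l\<close>.\<close>

definition admissible_cuts :: "'i ptree \<Rightarrow> nat list set set" where
  "admissible_cuts p =
     {c. c \<noteq> {} \<and> c \<subseteq> edges p \<and> (\<forall>l \<in> leaves p. card {e \<in> c. prefix e l} \<le> 1)}"

text \<open>The component of the root of \<open>p\<close> after deleting the edges in \<open>c\<close>.\<close>

function root_component :: "'i ptree \<Rightarrow> nat list set \<Rightarrow> 'i rtree" where
  "root_component (PNode i ps) c =
     RNode i (mset (map (\<lambda>k. root_component (ps ! k) {v. k # v \<in> c})
                        (filter (\<lambda>k. [k] \<notin> c) [0..<length ps])))"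
  by pat_completeness auto
termination
proof (relation "measure (\<lambda>(p, c). size p)")
  fix i :: 'i and ps :: "'i ptree list" and c k
  assume "k \<in> set (filter (\<lambda>k. [k] \<notin> c) [0..<length ps])"
  hence "ps ! k \<in> set ps" by auto
  hence "size (ps ! k) \<le> size_list size ps" by (simp add: size_list_estimation')
  thus "((ps ! k, {v. k # v \<in> c}), (PNode i ps, c)) \<in> measure (\<lambda>(p, c). size p)" by simp
qed simp

definition component :: "'i ptree \<Rightarrow> nat list set \<Rightarrow> nat list \<Rightarrow> 'i rtree" where
  "component p c v = root_component (subtree_at p v) {w. v @ w \<in> c}"

definition cut_root :: "'i ptree \<Rightarrow> nat list set \<Rightarrow> 'i rtree" where
  "cut_root p c = component p c []"

definition cut_pruned :: "'i ptree \<Rightarrow> nat list set \<Rightarrow> 'i forest" where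
  "cut_pruned p c = image_mset (component p c) (mset_set c)"


section \<open>The Connes-Kreimer Hopf algebra\<close>

text \<open>
  The polynomial algebra on the set of trees is the monoid algebra of the commutative monoid
  of forests; its tensor square is the monoid algebra of pairs of forests.
\<close>

type_synonym ('i, 'k) ck = "'i forest \<Rightarrow>\<^sub>0 'k"
type_synonym ('i, 'k) ck2 = "('i forest \<times> 'i forest) \<Rightarrow>\<^sub>0 'k"

definition scl :: "'k \<Rightarrow> ('m \<Rightarrow>\<^sub>0 'k) \<Rightarrow> ('m :: comm_monoid_add \<Rightarrow>\<^sub>0 'k :: comm_ring_1)" where
  "scl c x = Poly_Mapping.single 0 c * x"

lemma module_scl: "module (scl :: 'k \<Rightarrow> ('m \<Rightarrow>\<^sub>0 'k) \<Rightarrow> ('m :: comm_monoid_add \<Rightarrow>\<^sub>0 'k :: comm_ring_1))"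
  by unfold_locales
    (simp_all add: scl_def algebra_simps single_add mult_single single_one flip: mult.assoc)

definition lin_ext ::
  "('m \<Rightarrow> ('n \<Rightarrow>\<^sub>0 'k)) \<Rightarrow> ('m \<Rightarrow>\<^sub>0 'k) \<Rightarrow> ('n :: comm_monoid_add \<Rightarrow>\<^sub>0 'k :: comm_ring_1)" where
  "lin_ext \<phi> x = (\<Sum>m \<in> Poly_Mapping.keys x. scl (Poly_Mapping.lookup x m) (\<phi> m))"

definition tensor :: "('i, 'k :: comm_ring_1) ck \<Rightarrow> ('i, 'k) ck \<Rightarrow> ('i, 'k) ck2" where
  "tensor a b = lin_ext (\<lambda>f. lin_ext (\<lambda>g. Poly_Mapping.single (f, g) 1) b) a"

definition tree_coproduct :: "'i rtree \<Rightarrow> ('i, 'k :: comm_ring_1) ck2" where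
  "tree_coproduct t =
     Poly_Mapping.single ({#t#}, {#}) 1 + Poly_Mapping.single ({#}, {#t#}) 1 +
     (\<Sum>c \<in> admissible_cuts (planar_rep t).
        Poly_Mapping.single (cut_pruned (planar_rep t) c, {#cut_root (planar_rep t) c#}) 1)"

definition coproduct :: "('i, 'k :: comm_ring_1) ck \<Rightarrow> ('i, 'k) ck2" where
  "coproduct = lin_ext (\<lambda>f. \<Prod>t \<in># f. tree_coproduct t)"

definition counit :: "('i, 'k :: comm_ring_1) ck \<Rightarrow> 'k" where
  "counit x = Poly_Mapping.lookup x {#}"

definition is_antipode :: "(('i, 'k :: comm_ring_1) ck \<Rightarrow> ('i, 'k) ck) \<Rightarrow> bool" where
  "is_antipode S \<longleftrightarrow> module_hom scl scl S \<and>
     (\<forall>x. lin_ext (\<lambda>(f, g). S (Poly_Mapping.single f 1) * Poly_Mapping.single g 1) (coproduct x)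
            = scl (counit x) 1) \<and>
     (\<forall>x. lin_ext (\<lambda>(f, g). Poly_Mapping.single f 1 * S (Poly_Mapping.single g 1)) (coproduct x)
            = scl (counit x) 1)"

definition subalgebra :: "('i, 'k :: comm_ring_1) ck set \<Rightarrow> bool" where
  "subalgebra A \<longleftrightarrow> module.subspace scl A \<and> 1 \<in> A \<and> (\<forall>x \<in> A. \<forall>y \<in> A. x * y \<in> A)"

definition tensor_square :: "('i, 'k :: comm_ring_1) ck set \<Rightarrow> ('i, 'k) ck2 set" where
  "tensor_square A = module.span scl {tensor a b | a b. a \<in> A \<and> b \<in> A}"

text \<open>
  The antipode is the two-sided convolution inverse of the identity, hence unique; stability
  under the antipode is therefore stated for every map with that property.
\<close>

definition hopf_subalgebra :: "('i, 'k :: comm_ring_1) ck set \<Rightarrow> bool" where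
  "hopf_subalgebra A \<longleftrightarrow> subalgebra A \<and> coproduct ` A \<subseteq> tensor_square A \<and>
     (\<forall>S. is_antipode S \<longrightarrow> S ` A \<subseteq> A)"

primrec tree_degree :: "'i rtree \<Rightarrow> nat" where
  "tree_degree (RNode i f) = 1 + (\<Sum>n \<in># image_mset tree_degree f. n)"

definition forest_degree :: "'i forest \<Rightarrow> nat" where
  "forest_degree f = (\<Sum>t \<in># f. tree_degree t)"

lemma tree_degree_RNode: "tree_degree (RNode i f) = Suc (forest_degree f)"
  by (simp add: forest_degree_def)

declare tree_degree.simps [simp del]

lemma tree_degree_pos: "0 < tree_degree t"
  by (cases t) (simp add: tree_degree_RNode)

lemma forest_degree_simps [simp]:
  "forest_degree {#} = 0"
  "forest_degree (add_mset t f) = tree_degree t + forest_degree f"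
  "forest_degree (f + g) = forest_degree f + forest_degree g"
  by (simp_all add: forest_degree_def)

lemma size_le_forest_degree: "size f \<le> forest_degree f"
proof (induction f)
  case (add t f)
  then show ?case using tree_degree_pos[of t] by simp
qed simp

lemma finite_forests: "finite {f :: 'i :: finite forest. forest_degree f \<le> n}"
proof (induction n)
  case 0
  have "{f :: 'i forest. forest_degree f \<le> 0} \<subseteq> {{#}}"
  proof
    fix f :: "'i forest" assume "f \<in> {f. forest_degree f \<le> 0}"
    thus "f \<in> {{#}}" using size_le_forest_degree[of f] by simp
  qed
  thus ?case by (rule finite_subset) simp
next
  case (Suc n)
  let ?T = "(\<lambda>(i, g). RNode i g) ` (UNIV \<times> {f :: 'i forest. forest_degree f \<le> n})"
  have "{f :: 'i forest. forest_degree f \<le> Suc n} \<subseteq>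
          insert {#} ((\<lambda>(t, f). add_mset t f) ` (?T \<times> {f. forest_degree f \<le> n}))"
  proof
    fix f :: "'i forest" assume "f \<in> {f. forest_degree f \<le> Suc n}"
    hence d: "forest_degree f \<le> Suc n" by simp
    show "f \<in> insert {#} ((\<lambda>(t, f). add_mset t f) ` (?T \<times> {f. forest_degree f \<le> n}))"
    proof (cases f)
      case (add t g)
      obtain i h where t: "t = RNode i h" by (cases t)
      have "forest_degree h \<le> n" "forest_degree g \<le> n"
        using d by (auto simp: add t tree_degree_RNode)
      thus ?thesis by (force simp: add t)
    qed simp
  qed
  thus ?case by (rule finite_subset) (use Suc in auto)
qed


definition hom_component :: "nat \<Rightarrow> ('i :: finite rtree, 'k :: comm_ring_1) mps \<Rightarrow> ('i, 'k) ck" where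
  "hom_component n Y = Abs_poly_mapping (\<lambda>f. if forest_degree f = n then coeff Y f else 0)"

lemma lookup_hom_component:
  "Poly_Mapping.lookup (hom_component n Y) f = (if forest_degree f = n then coeff Y f else 0)"
proof -
  have "finite {f. (if forest_degree f = n then coeff Y f else 0) \<noteq> 0}"
    by (rule finite_subset[OF _ finite_forests[of n]]) auto
  thus ?thesis by (simp add: hom_component_def Abs_poly_mapping_inverse)
qed

text \<open>
  Grafting, extended linearly and continuously: the sum has at most one term, and none if
  \<open>f\<close> is not a single tree with root decorated by \<open>i\<close>.
\<close>

definition graft :: "'i \<Rightarrow> ('i rtree, 'k :: comm_ring_1) mps \<Rightarrow> ('i rtree, 'k) mps" where
  "graft i Y = Abs_mps (\<lambda>f. \<Sum>g \<in> {g. f = {#RNode i g#}}. coeff Y g)"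


section \<open>Systems of combinatorial Dyson-Schwinger equations\<close>

type_synonym ('i, 'k) sdse = "'i \<Rightarrow> ('i, 'k) mps"

definition is_solution ::
  "('i :: finite, 'k :: comm_ring_1) sdse \<Rightarrow> ('i \<Rightarrow> ('i rtree, 'k) mps) \<Rightarrow> bool" where
  "is_solution F X \<longleftrightarrow> (\<forall>i. X i = graft i (mps_subst (F i) X))"

definition solution :: "('i :: finite, 'k :: comm_ring_1) sdse \<Rightarrow> 'i \<Rightarrow> ('i rtree, 'k) mps" where
  "solution F = (THE X. is_solution F X)"

lemma coeff_graft: "coeff (graft i Y) {#RNode j g#} = (if i = j then coeff Y g else 0)"
proof -
  have "{g'. {#RNode j g#} = {#RNode i g'#}} = (if i = j then {g} else {})" by auto
  thus ?thesis by (simp add: graft_def)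
qed

lemma coeff_graft_0: "(\<And>g. f \<noteq> {#RNode i g#}) \<Longrightarrow> coeff (graft i Y) f = 0"
  by (simp add: graft_def)

lemma coeff_mset_prod_cong:
  assumes "\<And>j f. forest_degree f \<le> n \<Longrightarrow> coeff (X j) f = coeff (Y j) f"
    and "forest_degree f \<le> n"
  shows "coeff (\<Prod>j \<in># \<alpha>. X j) f = coeff (\<Prod>j \<in># \<alpha>. Y j) f"
  using assms(2)
proof (induction \<alpha> arbitrary: f)
  case (add j \<alpha>)
  show ?case
    unfolding image_mset_add_mset prod_mset.add_mset coeff_mult
    by (rule sum.cong) (use add assms(1) in auto)
qed simp

lemma coeff_graft_subst_cong:
  assumes "\<And>j f. forest_degree f \<le> n \<Longrightarrow> coeff (X j) f = coeff (Y j) f"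
    and "forest_degree f \<le> Suc n"
  shows "coeff (graft i (mps_subst F X)) f = coeff (graft i (mps_subst F Y)) f"
proof (cases "\<exists>g. f = {#RNode i g#}")
  case True
  then obtain g where f: "f = {#RNode i g#}" by blast
  hence g: "forest_degree g \<le> n" using assms(2) by (simp add: tree_degree_RNode)
  show ?thesis
    unfolding f coeff_graft mps_subst_def coeff_Abs_mps
    using coeff_mset_prod_cong[of n X Y g, OF assms(1) g] by simp
qed (simp add: coeff_graft_0)

theorem ex1_solution:
  fixes F :: "('i :: finite, 'k :: comm_ring_1) sdse"
  shows "\<exists>!X. is_solution F X"
proof (rule ex_ex1I)
  define \<Phi> where "\<Phi> X i = graft i (mps_subst (F i) X)" for X i
  define Z where "Z n = (\<Phi> ^^ n) (\<lambda>_. 0)" for n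
  have Z_Suc: "Z (Suc n) i = graft i (mps_subst (F i) (Z n))" for n i
    by (simp add: Z_def \<Phi>_def)
  have Z0: "coeff (Z n i) {#} = 0" for n i
    by (cases n) (simp_all add: Z_def zero_mps.rep_eq \<Phi>_def coeff_graft_0)
  have step: "coeff (Z (Suc n) i) f = coeff (Z n i) f" if "forest_degree f \<le> n" for n i f
    using that
  proof (induction n arbitrary: i f)
    case 0
    hence "f = {#}" using size_le_forest_degree[of f] by simp
    thus ?case by (simp add: Z0)
  next
    case (Suc n)
    show ?case unfolding Z_Suc[of "Suc n"] Z_Suc[of n i]
      by (rule coeff_graft_subst_cong[of n]) (use Suc in auto)
  qed
  have stable: "coeff (Z m i) f = coeff (Z n i) f" if "forest_degree f \<le> n" "n \<le> m" for m n i f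
    using that(2) by (induction m rule: dec_induct) (use that(1) step in auto)
  define X where "X i = Abs_mps (\<lambda>f. coeff (Z (forest_degree f) i) f)" for i
  have X: "coeff (X i) f = coeff (Z n i) f" if "forest_degree f \<le> n" for i f n
    unfolding X_def using stable[of f "forest_degree f" n i] that by simp
  have "X i = graft i (mps_subst (F i) X)" for i
  proof (rule mps_eqI)
    fix f :: "'i forest"
    let ?n = "forest_degree f"
    have "coeff (X i) f = coeff (Z (Suc ?n) i) f" by (rule X) simp
    also have "\<dots> = coeff (graft i (mps_subst (F i) X)) f"
      unfolding Z_Suc by (rule coeff_graft_subst_cong[of ?n]) (simp_all add: X)
    finally show "coeff (X i) f = coeff (graft i (mps_subst (F i) X)) f" .
  qed
  thus "\<exists>X. is_solution F X" unfolding is_solution_def by blast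
next
  fix X Y assume X: "is_solution F X" and Y: "is_solution F Y"
  have "coeff (X i) f = coeff (Y i) f" if "forest_degree f \<le> n" for n i f
    using that
  proof (induction n arbitrary: i f)
    case 0
    hence f: "f = {#}" using size_le_forest_degree[of f] by simp
    have "coeff (graft i A) {#} = 0" for A :: "('i rtree, 'k) mps" by (simp add: coeff_graft_0)
    thus ?case using X Y unfolding is_solution_def f by metis
  next
    case (Suc n)
    have "coeff (graft i (mps_subst (F i) X)) f = coeff (graft i (mps_subst (F i) Y)) f"
      by (rule coeff_graft_subst_cong[of n]) (use Suc in auto)
    thus ?case using X Y unfolding is_solution_def by metis
  qed
  thus "X = Y" by (intro ext mps_eqI) blast
qed

lemma solution: "is_solution F (solution F)"
  unfolding solution_def using ex1_solution by (rule theI')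

definition solution_algebra :: "('i :: finite, 'k :: comm_ring_1) sdse \<Rightarrow> ('i, 'k) ck set" where
  "solution_algebra F = subalgebra hull {hom_component n (solution F i) | i n. True}"

definition hopf_sdse :: "('i :: finite, 'k :: comm_ring_1) sdse \<Rightarrow> bool" where
  "hopf_sdse F \<longleftrightarrow> hopf_subalgebra (solution_algebra F)"

definition dependency :: "('i, 'k :: comm_ring_1) sdse \<Rightarrow> 'i \<Rightarrow> 'i \<Rightarrow> bool" where
  "dependency F i j \<longleftrightarrow> mps_deriv j (F i) \<noteq> 0"

definition connected_sdse :: "('i, 'k :: comm_ring_1) sdse \<Rightarrow> bool" where
  "connected_sdse F \<longleftrightarrow> (\<forall>i j. (\<lambda>x y. dependency F x y \<or> dependency F y x)\<^sup>*\<^sup>* i j)"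

definition symmetric_sdse :: "('i, 'k :: comm_ring_1) sdse \<Rightarrow> bool" where
  "symmetric_sdse F \<longleftrightarrow> (\<forall>i. \<not> dependency F i i) \<and>
     (\<forall>i j. i \<noteq> j \<longrightarrow> (dependency F i j \<longleftrightarrow> dependency F j i))"

definition change_variables :: "('i \<Rightarrow> 'k) \<Rightarrow> ('i, 'k :: comm_ring_1) sdse \<Rightarrow> ('i, 'k) sdse" where
  "change_variables l F = (\<lambda>i. mps_subst (F i) (\<lambda>j. mps_const (l j) * mps_var j))"

definition two_multicyclic :: "('i :: finite, 'k :: field) sdse \<Rightarrow> bool" where
  "two_multicyclic F \<longleftrightarrow>
     (\<exists>I\<^sub>1 I\<^sub>2 l. I\<^sub>1 \<noteq> {} \<and> I\<^sub>2 \<noteq> {} \<and> I\<^sub>1 \<inter> I\<^sub>2 = {} \<and> I\<^sub>1 \<union> I\<^sub>2 = UNIV \<and> (\<forall>j. l j \<noteq> 0) \<and>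
        (\<forall>x \<in> I\<^sub>1. change_variables l F x = 1 + (\<Sum>y \<in> I\<^sub>2. mps_var y)) \<and>
        (\<forall>x \<in> I\<^sub>2. change_variables l F x = 1 + (\<Sum>y \<in> I\<^sub>1. mps_var y)))"

definition quasi_complete :: "('i :: finite, 'k :: field) sdse \<Rightarrow> bool" where
  "quasi_complete F \<longleftrightarrow>
     (\<exists>(M :: nat) P l. 2 \<le> M \<and> (\<forall>i \<in> {1..M}. P i \<noteq> {}) \<and> disjoint_family_on P {1..M} \<and>
        (\<Union>i \<in> {1..M}. P i) = UNIV \<and> (\<forall>j. l j \<noteq> 0) \<and>
        (\<forall>i \<in> {1..M}. \<forall>x \<in> P i. change_variables l F x =
           (\<Prod>j \<in> {1..M} - {i}. mps_inverse (1 - (\<Sum>y \<in> P j. mps_var y)))))"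

end

theory Submission
  imports Defs "HOL-Library.FuncSet"
begin

text \<open>
  Keep from \<open>\<Delta>(X\<^sub>i)\<close> only the terms whose left factor is a product of one-vertex trees, and read such a
  product as a monomial in the variables \<open>h\<^sub>j\<close>.  By the cocycle property of grafting and Taylor's formula,
  the coefficient of a tree \<open>t\<close> with root \<open>i\<close> in the right factor is, up to the symmetry factor of \<open>t\<close>,
  the product over the vertices \<open>v\<close> of \<open>t\<close> of the partial derivatives \<open>\<partial>\<^sup>\<alpha>F\<^sub>j\<close>, where \<open>j\<close> decorates \<open>v\<close> and
  \<open>\<alpha>\<close> collects the decorations of its children.  If the system is Hopf, this series equals its constant
  term times a series that depends only on \<open>i\<close> and the degree of \<open>t\<close>.  Comparing the linear terms for a
  few small trees shows that the graph is complete multipartite and that, after a change of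
  variables, the linear parts are \<open>1 + \<Sum> h\<^sub>j\<close> over the neighbours.  Write \<open>\<beta>\<^sub>i\<close> for \<open>\<partial>\<^sub>j\<^sup>2F\<^sub>i(0)\<close>
  with \<open>j\<close> a neighbour of \<open>i\<close>.  Chains \<open>i - j - i - \<dots>\<close> and the tree \<open>i(j(i, i))\<close> show that either all \<open>\<beta>\<^sub>i\<close>
  are \<open>0\<close>, so that there are no triangles and every \<open>F\<^sub>i\<close> is affine, or all are \<open>2\<close>; then corollas give a
  recurrence for the coefficients of \<open>F\<^sub>i\<close> that the products of geometric series also satisfy.
\<close>


subsection \<open>Series in several variables\<close>

lemmas mps_rep_eqs = zero_mps.rep_eq one_mps.rep_eq plus_mps.rep_eq minus_mps.rep_eq uminus_mps.rep_eq

lemma coeff_deriv: "coeff (mps_deriv j f) M = of_nat (count M j + 1) * coeff f (add_mset j M)"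
  by (simp add: mps_deriv_def)

lemma coeff_const: "coeff (mps_const c) M = (if M = {#} then c else 0)"
  by (simp add: mps_const_def)

lemma coeff_var: "coeff (mps_var j) M = (if M = {#j#} then 1 else 0)"
  by (simp add: mps_var_def)

lemma coeff_mult_empty [simp]: "coeff (f * g) {#} = coeff f {#} * coeff g {#}"
proof -
  have "{(N, L). N + L = {#}} = {({#} :: 'a multiset, {#} :: 'a multiset)}" by auto
  thus ?thesis by (simp add: coeff_mult)
qed

lemma coeff_prod_mset_empty:
  "coeff (\<Prod>x \<in># A. f x) {#} = (\<Prod>x \<in># A. coeff (f x) {#})"
  by (induction A) (simp_all add: one_mps.rep_eq)

definition monomial :: "'a multiset \<Rightarrow> ('a, 'k :: comm_ring_1) mps" where
  "monomial M = Abs_mps (\<lambda>N. if N = M then 1 else 0)"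

lemma coeff_monomial: "coeff (monomial M) N = (if N = M then 1 else 0)"
  by (simp add: monomial_def)

lemma monomial_empty: "monomial {#} = 1"
  by (rule mps_eqI) (simp add: coeff_monomial one_mps.rep_eq)

lemma monomial_single: "monomial {#j#} = mps_var j"
  by (rule mps_eqI) (simp add: coeff_monomial coeff_var)

lemma monomial_add: "monomial (M + N) = monomial M * monomial N"
proof (rule mps_eqI)
  fix K
  have "coeff (monomial M * monomial N) K =
      (\<Sum>p \<in> {(A, B). A + B = K}. if p = (M, N) then 1 else 0)"
    unfolding coeff_mult by (rule sum.cong) (auto simp: coeff_monomial split: if_splits)
  also have "\<dots> = coeff (monomial (M + N)) K"
    by (auto simp: coeff_monomial finite_msplits)
  finally show "coeff (monomial (M + N)) K = coeff (monomial M * monomial N) K" ..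
qed

lemma prod_mset_var: "(\<Prod>j \<in># \<alpha>. mps_var j) = monomial \<alpha>"
proof (induction \<alpha>)
  case (add j \<alpha>)
  have "monomial (add_mset j \<alpha>) = mps_var j * (monomial \<alpha> :: ('a, 'b) mps)"
    using monomial_add[of "{#j#}" \<alpha>] by (simp add: monomial_single)
  thus ?case using add by simp
qed (simp add: monomial_empty)

lemma coeff_const_mult: "coeff (mps_const c * f) M = c * coeff f M"
proof -
  have "coeff (mps_const c * f) M
      = (\<Sum>p \<in> {(N, L). N + L = M}. if p = ({#}, M) then c * coeff f M else 0)"
    unfolding coeff_mult by (rule sum.cong) (auto simp: coeff_const split: if_splits)
  thus ?thesis by (simp add: finite_msplits)
qed

lemma coeff_var_mult:
  "coeff (mps_var j * f) M = (if j \<in># M then coeff f (M - {#j#}) else 0)"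
proof (cases "j \<in># M")
  case True
  then obtain L where M: "M = add_mset j L" by (metis insert_DiffM)
  have "(case p of (N, K) \<Rightarrow> coeff (mps_var j) N * coeff f K)
      = (if p = ({#j#}, L) then coeff f L else 0)" if "p \<in> {(N, K). N + K = M}" for p
    using that by (cases "fst p = {#j#}") (auto simp: coeff_var M)
  hence "coeff (mps_var j * f) M = (\<Sum>p \<in> {(N, K). N + K = M}. if p = ({#j#}, L) then coeff f L else 0)"
    unfolding coeff_mult by (intro sum.cong) auto
  thus ?thesis by (simp add: finite_msplits M)
next
  case False
  hence "coeff (mps_var j) N * coeff f L = 0" if "N + L = M" for N L
    using that by (auto simp: coeff_var)
  thus ?thesis unfolding coeff_mult using False by (auto intro!: sum.neutral)
qed

lemma coeff_mult_single:
  "coeff (f * g) {#l#} = coeff f {#l#} * coeff g {#} + coeff f {#} * coeff g {#l#}"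
proof -
  have "{(N, L). N + L = {#l#}} = {({#l#}, {#}), ({#}, {#l#})}"
    by (auto simp: union_is_single)
  thus ?thesis by (simp add: coeff_mult)
qed

lemma mps_deriv_add: "mps_deriv j (f + g) = mps_deriv j f + mps_deriv j g"
  by (rule mps_eqI) (simp add: coeff_deriv plus_mps.rep_eq algebra_simps)

lemma mps_deriv_commute: "mps_deriv i (mps_deriv j f) = mps_deriv j (mps_deriv i f)"
  by (rule mps_eqI) (auto simp: coeff_deriv add_mset_commute)

lemma coeff_of_nat_mult: "coeff (of_nat n * f) M = of_nat n * coeff f M"
  by (induction n) (simp_all add: mps_rep_eqs distrib_right)

text \<open>Half of the Leibniz rule: splits without \<open>j\<close> in \<open>N\<close> have
  weight 0, and from the others one \<open>j\<close> is removed from \<open>N\<close>.\<close>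

lemma sum_splits_count:
  fixes \<phi> :: "'a multiset \<Rightarrow> 'a multiset \<Rightarrow> 'k :: comm_ring_1"
  shows "(\<Sum>(N, L) \<in> {(N, L). N + L = add_mset j M}. of_nat (count N j) * \<phi> N L)
       = (\<Sum>(N, L) \<in> {(N, L). N + L = M}. of_nat (count N j + 1) * \<phi> (add_mset j N) L)"
proof -
  have "(\<Sum>(N, L) \<in> {(N, L). N + L = add_mset j M}. of_nat (count N j) * \<phi> N L)
      = (\<Sum>(N, L) \<in> {(N, L). N + L = add_mset j M \<and> j \<in># N}. of_nat (count N j) * \<phi> N L)"
    by (rule sum.mono_neutral_right)
      (auto simp: finite_msplits, metis count_eq_zero_iff mult_zero_left of_nat_0)
  also have "\<dots> = (\<Sum>(N, L) \<in> {(N, L). N + L = M}. of_nat (count N j + 1) * \<phi> (add_mset j N) L)"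
    by (rule sum.reindex_bij_witness[of _ "\<lambda>(N, L). (add_mset j N, L)" "\<lambda>(N, L). (N - {#j#}, L)"])
      (auto dest!: multi_member_split)
  finally show ?thesis .
qed

lemma mps_deriv_mult: "mps_deriv j (f * g) = mps_deriv j f * g + f * mps_deriv j g"
proof (rule mps_eqI)
  fix M
  let ?S = "{(N, L). N + L = add_mset j M}"
  have "coeff (mps_deriv j (f * g)) M =
      (\<Sum>(N, L) \<in> ?S. of_nat (count (add_mset j M) j) * (coeff f N * coeff g L))"
    by (simp add: coeff_deriv coeff_mult sum_distrib_left case_prod_unfold)
  \<comment> \<open>The factor \<open>count M j + 1\<close> is the multiplicity of \<open>j\<close>
    in \<open>N + L\<close>; it is shared out between the two parts.\<close>
  also have "\<dots> = (\<Sum>(N, L) \<in> ?S. of_nat (count N j) * (coeff f N * coeff g L)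
      + of_nat (count L j) * (coeff f N * coeff g L))"
    by (rule sum.cong[OF refl]) (clarsimp simp flip: distrib_right of_nat_add count_union)
  also have "\<dots> = (\<Sum>(N, L) \<in> ?S. of_nat (count N j) * (coeff f N * coeff g L))
      + (\<Sum>(N, L) \<in> ?S. of_nat (count L j) * (coeff f N * coeff g L))"
    by (simp add: case_prod_unfold sum.distrib)
  also have "(\<Sum>(N, L) \<in> ?S. of_nat (count L j) * (coeff f N * coeff g L))
      = (\<Sum>(N, L) \<in> ?S. of_nat (count N j) * (coeff g N * coeff f L))"
    by (rule sum.reindex_bij_witness[of _ prod.swap prod.swap]) (auto simp: ac_simps)
  also have "(\<Sum>(N, L) \<in> ?S. of_nat (count N j) * (coeff f N * coeff g L)) = coeff (mps_deriv j f * g) M"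
    by (simp add: sum_splits_count coeff_mult coeff_deriv mult.assoc)
  also have "(\<Sum>(N, L) \<in> ?S. of_nat (count N j) * (coeff g N * coeff f L)) = coeff (mps_deriv j g * f) M"
    by (simp add: sum_splits_count coeff_mult coeff_deriv mult.assoc)
  finally show "coeff (mps_deriv j (f * g)) M = coeff (mps_deriv j f * g + f * mps_deriv j g) M"
    by (simp add: plus_mps.rep_eq mult.commute)
qed

lemma mps_deriv_one [simp]: "mps_deriv j 1 = 0"
  by (rule mps_eqI) (simp add: coeff_deriv mps_rep_eqs)

lemma mps_deriv_var: "mps_deriv j (mps_var i) = (if i = j then 1 else 0)"
  by (rule mps_eqI) (auto simp: coeff_deriv mps_rep_eqs coeff_var)

text \<open>Only \<open>X r\<close> depends on \<open>j\<close>, so each of its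
  \<open>count \<alpha> r\<close> occurrences gives the same Leibniz term. If \<open>r\<close> does
  not occur, this factor is 0 and the truncated difference is harmless.\<close>

lemma mps_deriv_prod_mset:
  assumes "\<And>i. i \<noteq> r \<Longrightarrow> mps_deriv j (X i) = 0"
  shows "mps_deriv j (\<Prod>i \<in># \<alpha>. X i)
    = of_nat (count \<alpha> r) * (\<Prod>i \<in># \<alpha> - {#r#}. X i) * mps_deriv j (X r)"
proof (induction \<alpha>)
  case (add i \<alpha>)
  show ?case
  proof (cases "i = r")
    case False
    hence "add_mset i \<alpha> - {#r#} = add_mset i (\<alpha> - {#r#})"
      by (auto simp: multiset_eq_iff)
    with False assms[of i] add show ?thesis
      by (simp add: mps_deriv_mult ac_simps)
  next
    case True
    have *: "of_nat (count \<alpha> r) * (X r * (\<Prod>i \<in># \<alpha> - {#r#}. X i)) = of_nat (count \<alpha> r) * (\<Prod>i \<in># \<alpha>. X i)"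
    proof (cases "r \<in># \<alpha>")
      case True
      then obtain \<beta> where "\<alpha> = add_mset r \<beta>" by (metis insert_DiffM)
      thus ?thesis by simp
    qed (simp add: not_in_iff)
    have "mps_deriv j (\<Prod>i \<in># add_mset i \<alpha>. X i)
        = mps_deriv j (X r) * (\<Prod>i \<in># \<alpha>. X i)
          + (of_nat (count \<alpha> r) * (X r * (\<Prod>i \<in># \<alpha> - {#r#}. X i))) * mps_deriv j (X r)"
      unfolding True image_mset_add_mset prod_mset.add_mset mps_deriv_mult add by (simp only: ac_simps)
    also have "\<dots> = of_nat (count \<alpha> r + 1) * (\<Prod>i \<in># \<alpha>. X i) * mps_deriv j (X r)"
      unfolding * by (simp add: distrib_left distrib_right mult.commute)
    finally show ?thesis using True by simp
  qed
qed simp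


subsection \<open>Substitution\<close>

text \<open>Makes the sums in \<open>mps_subst\<close> finite; on an infinite support
  \<open>Sum_any\<close> would return the default value 0.\<close>

definition summable_family :: "('a \<Rightarrow> ('b, 'k :: comm_ring_1) mps) \<Rightarrow> bool" where
  "summable_family X \<longleftrightarrow> (\<forall>M. finite {\<alpha>. coeff (\<Prod>j \<in># \<alpha>. X j) M \<noteq> 0})"

lemma coeff_subst:
  assumes "finite S" "\<And>\<alpha>. \<alpha> \<notin> S \<Longrightarrow> coeff f \<alpha> * coeff (\<Prod>j \<in># \<alpha>. X j) M = 0"
  shows "coeff (mps_subst f X) M = (\<Sum>\<alpha> \<in> S. coeff f \<alpha> * coeff (\<Prod>j \<in># \<alpha>. X j) M)"
  unfolding mps_subst_def coeff_Abs_mps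
  by (rule Sum_any.expand_superset) (use assms in auto)

lemma mps_subst_one: "mps_subst 1 X = 1"
proof (rule mps_eqI)
  fix M
  show "coeff (mps_subst 1 X) M = coeff 1 M"
    by (subst coeff_subst[of "{{#}}"]) (auto simp: one_mps.rep_eq)
qed

lemma mps_subst_mult:
  fixes X :: "'a \<Rightarrow> ('b, 'k :: comm_ring_1) mps"
  assumes X: "summable_family X"
  shows "mps_subst (f * g) X = mps_subst f X * mps_subst g X"
proof (rule mps_eqI)
  fix M :: "'b multiset"
  define p where "p \<alpha> = (\<Prod>j \<in># \<alpha>. X j)" for \<alpha>
  define T where "T = {(N, L). N + L = M}"
  \<comment> \<open>\<open>U\<close> holds every multi-index that can reach a part of a split of
    \<open>M\<close>: all sums then run over one finite set, and the sum over
    \<open>U \<times> U\<close> factorises.\<close>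
  define U where "U = (\<Union>(N, L) \<in> T. {\<alpha>. coeff (p \<alpha>) N \<noteq> 0} \<union> {\<alpha>. coeff (p \<alpha>) L \<noteq> 0})"
  have finT: "finite T" unfolding T_def by (rule finite_msplits)
  have fin: "finite {\<alpha>. coeff (p \<alpha>) N \<noteq> 0}" for N
    using X unfolding summable_family_def p_def by blast
  have finU: "finite U" unfolding U_def using finT fin by auto
  have p_add: "coeff (p (\<alpha> + \<beta>)) M = (\<Sum>(N, L) \<in> T. coeff (p \<alpha>) N * coeff (p \<beta>) L)" for \<alpha> \<beta>
    by (simp add: p_def coeff_mult T_def)
  have U: "\<alpha> \<in> U \<and> \<beta> \<in> U" if nz: "coeff (p (\<alpha> + \<beta>)) M \<noteq> 0" for \<alpha> \<beta>
  proof -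
    obtain q where "q \<in> T" "(case q of (N, L) \<Rightarrow> coeff (p \<alpha>) N * coeff (p \<beta>) L) \<noteq> 0"
      using nz unfolding p_add by (meson sum.neutral)
    thus ?thesis unfolding U_def by (force split: prod.splits)
  qed
  define S where "S = {\<alpha>. coeff (p \<alpha>) M \<noteq> 0}"
  have "coeff (mps_subst (f * g) X) M = (\<Sum>\<alpha> \<in> S. coeff (f * g) \<alpha> * coeff (p \<alpha>) M)"
    unfolding p_def by (rule coeff_subst) (use fin[of M] in \<open>auto simp: S_def p_def\<close>)
  also have "\<dots> = (\<Sum>\<alpha> \<in> S. \<Sum>q \<in> {(\<beta>, \<gamma>). \<beta> + \<gamma> = \<alpha>}.
      coeff f (fst q) * coeff g (snd q) * coeff (p \<alpha>) M)"
    by (simp add: coeff_mult sum_distrib_right case_prod_unfold)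
  also have "\<dots> = (\<Sum>(\<alpha>, q) \<in> (SIGMA \<alpha> : S. {(\<beta>, \<gamma>). \<beta> + \<gamma> = \<alpha>}).
      coeff f (fst q) * coeff g (snd q) * coeff (p \<alpha>) M)"
    by (rule sum.Sigma) (use finite_msplits fin in \<open>auto simp: S_def\<close>)
  also have "\<dots> = (\<Sum>q \<in> {(\<beta>, \<gamma>). \<beta> + \<gamma> \<in> S}.
      coeff f (fst q) * coeff g (snd q) * coeff (p (fst q + snd q)) M)"
    by (rule sum.reindex_bij_witness[of _ "\<lambda>q. (fst q + snd q, q)" snd]) auto
  also have "\<dots> = (\<Sum>q \<in> U \<times> U. coeff f (fst q) * coeff g (snd q) * coeff (p (fst q + snd q)) M)"
    by (rule sum.mono_neutral_left) (use finU U in \<open>auto simp: S_def\<close>)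
  also have "\<dots> = (\<Sum>q \<in> U \<times> U. \<Sum>(N, L) \<in> T.
      (coeff f (fst q) * coeff (p (fst q)) N) * (coeff g (snd q) * coeff (p (snd q)) L))"
    by (simp add: p_add sum_distrib_left case_prod_unfold ac_simps)
  also have "\<dots> = (\<Sum>(N, L) \<in> T. \<Sum>q \<in> U \<times> U.
      (coeff f (fst q) * coeff (p (fst q)) N) * (coeff g (snd q) * coeff (p (snd q)) L))"
    by (subst sum.swap) (simp add: case_prod_unfold)
  also have "\<dots> = (\<Sum>(N, L) \<in> T. (\<Sum>\<alpha> \<in> U. coeff f \<alpha> * coeff (p \<alpha>) N) * (\<Sum>\<alpha> \<in> U. coeff g \<alpha> * coeff (p \<alpha>) L))"
    by (simp add: sum_product sum.cartesian_product case_prod_unfold)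
  also have "\<dots> = (\<Sum>(N, L) \<in> T. coeff (mps_subst f X) N * coeff (mps_subst g X) L)"
  proof (rule sum.cong[OF refl], clarify)
    fix N L assume "(N, L) \<in> T"
    hence "coeff (p \<alpha>) N = 0 \<and> coeff (p \<alpha>) L = 0" if "\<alpha> \<notin> U" for \<alpha>
      using that unfolding U_def by auto
    thus "(\<Sum>\<alpha> \<in> U. coeff f \<alpha> * coeff (p \<alpha>) N) * (\<Sum>\<alpha> \<in> U. coeff g \<alpha> * coeff (p \<alpha>) L)
        = coeff (mps_subst f X) N * coeff (mps_subst g X) L"
      unfolding p_def using coeff_subst[OF finU, of f X N] coeff_subst[OF finU, of g X L] by simp
  qed
  also have "\<dots> = coeff (mps_subst f X * mps_subst g X) M"
    by (simp add: coeff_mult T_def)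
  finally show "coeff (mps_subst (f * g) X) M = coeff (mps_subst f X * mps_subst g X) M" .
qed

lemma mps_subst_prod_mset:
  assumes "summable_family X"
  shows "mps_subst (\<Prod>j \<in># \<alpha>. Y j) X = (\<Prod>j \<in># \<alpha>. mps_subst (Y j) X)"
  by (induction \<alpha>) (simp_all add: mps_subst_one mps_subst_mult[OF assms])

lemma mps_subst_compose:
  assumes X: "summable_family X" and Y: "summable_family Y"
    and XY: "summable_family (\<lambda>j. mps_subst (X j) Y)"
  shows "mps_subst (mps_subst f X) Y = mps_subst f (\<lambda>j. mps_subst (X j) Y)"
proof (rule mps_eqI)
  fix M
  \<comment> \<open>\<open>S\<close> and \<open>R\<close> are the multi-indices that can contribute
    at \<open>M\<close>; both sides expand to the same finite double sum over them.\<close>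
  define S where "S = {\<beta>. coeff (\<Prod>j \<in># \<beta>. Y j) M \<noteq> 0}"
  define R where "R = (\<Union>\<beta> \<in> S. {\<alpha>. coeff (\<Prod>j \<in># \<alpha>. X j) \<beta> \<noteq> 0})"
  have finS: "finite S" using Y by (simp add: S_def summable_family_def)
  have finR: "finite R" using finS X by (auto simp: R_def summable_family_def)
  have subst_p: "coeff (\<Prod>j \<in># \<alpha>. mps_subst (X j) Y) M
      = (\<Sum>\<beta> \<in> S. coeff (\<Prod>j \<in># \<alpha>. X j) \<beta> * coeff (\<Prod>j \<in># \<beta>. Y j) M)" for \<alpha>
    unfolding mps_subst_prod_mset[OF Y, symmetric]
    by (rule coeff_subst[OF finS]) (auto simp: S_def)
  have "coeff (mps_subst (mps_subst f X) Y) M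
      = (\<Sum>\<beta> \<in> S. coeff (mps_subst f X) \<beta> * coeff (\<Prod>j \<in># \<beta>. Y j) M)"
    by (rule coeff_subst[OF finS]) (auto simp: S_def)
  also have "\<dots> = (\<Sum>\<beta> \<in> S. (\<Sum>\<alpha> \<in> R. coeff f \<alpha> * coeff (\<Prod>j \<in># \<alpha>. X j) \<beta>) * coeff (\<Prod>j \<in># \<beta>. Y j) M)"
    by (rule sum.cong[OF refl], subst coeff_subst[OF finR]) (auto simp: R_def)
  also have "\<dots> = (\<Sum>\<alpha> \<in> R. coeff f \<alpha> * coeff (\<Prod>j \<in># \<alpha>. mps_subst (X j) Y) M)"
    unfolding subst_p sum_distrib_left sum_distrib_right by (subst sum.swap) (simp add: mult.assoc)
  also have "\<dots> = coeff (mps_subst f (\<lambda>j. mps_subst (X j) Y)) M"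
    by (rule coeff_subst[OF finR, symmetric]) (auto simp: R_def subst_p intro!: sum.neutral)
  finally show "coeff (mps_subst (mps_subst f X) Y) M = coeff (mps_subst f (\<lambda>j. mps_subst (X j) Y)) M" .
qed

lemma finite_multisets_size_le: "finite {\<alpha> :: 'a :: finite multiset. size \<alpha> \<le> n}"
proof (induction n)
  case (Suc n)
  have "{\<alpha> :: 'a multiset. size \<alpha> \<le> Suc n}
      \<subseteq> insert {#} ((\<lambda>(x, \<alpha>). add_mset x \<alpha>) ` (UNIV \<times> {\<alpha>. size \<alpha> \<le> n}))"
  proof
    fix \<alpha> :: "'a multiset" assume "\<alpha> \<in> {\<alpha>. size \<alpha> \<le> Suc n}"
    thus "\<alpha> \<in> insert {#} ((\<lambda>(x, \<alpha>). add_mset x \<alpha>) ` (UNIV \<times> {\<alpha>. size \<alpha> \<le> n}))"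
      by (cases \<alpha>) force+
  qed
  thus ?case by (rule finite_subset) (use Suc in auto)
qed simp

lemma coeff_prod_mset_size_less:
  assumes "\<And>j. coeff (X j) {#} = 0" "size M < size \<alpha>"
  shows "coeff (\<Prod>j \<in># \<alpha>. X j) M = 0"
  using assms(2)
proof (induction \<alpha> arbitrary: M)
  case (add j \<alpha>)
  show ?case unfolding image_mset_add_mset prod_mset.add_mset
    by (rule coeff_mult_size_less[of 1 _ "size \<alpha>"]) (use add assms(1) in auto)
qed simp

lemma summable_familyI:
  fixes X :: "'a :: finite \<Rightarrow> ('b, 'k :: comm_ring_1) mps"
  assumes "\<And>j. coeff (X j) {#} = 0"
  shows "summable_family X"
  unfolding summable_family_def
proof
  fix M
  show "finite {\<alpha>. coeff (\<Prod>j \<in># \<alpha>. X j) M \<noteq> 0}"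
    by (rule finite_subset[OF _ finite_multisets_size_le[of "size M"]])
      (use coeff_prod_mset_size_less[of X M] assms in \<open>force simp: not_less[symmetric]\<close>)
qed

text \<open>Chain rule for a variable that occurs in only one of the substituted series.\<close>

lemma mps_deriv_subst:
  fixes X :: "'a \<Rightarrow> ('b, 'k :: comm_ring_1) mps"
  assumes X: "summable_family X" and 0: "\<And>j. j \<noteq> r \<Longrightarrow> mps_deriv v (X j) = 0"
  shows "mps_deriv v (mps_subst f X) = mps_deriv v (X r) * mps_subst (mps_deriv r f) X"
proof (rule mps_eqI)
  fix M :: "'b multiset"
  define p where "p \<alpha> = (\<Prod>j \<in># \<alpha>. X j)" for \<alpha>
  define T where "T = {(N, L). N + L = M}"
  have finT: "finite T" unfolding T_def by (rule finite_msplits)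
  have fin: "finite {\<alpha>. coeff (p \<alpha>) N \<noteq> 0}" for N
    using X unfolding summable_family_def p_def by blast
  \<comment> \<open>\<open>U\<close> holds the multi-indices needed on the right, and its image
    under \<open>add_mset r\<close> contains those with an \<open>r\<close> that contribute on the
    left; the shift by \<open>r\<close> then matches the two sums.\<close>
  define U where "U = {\<alpha>. coeff (p (add_mset r \<alpha>)) (add_mset v M) \<noteq> 0}
    \<union> (\<Union>(N, L) \<in> T. {\<alpha>. coeff (p \<alpha>) L \<noteq> 0})"
  define S where "S = {\<alpha>. coeff (p \<alpha>) (add_mset v M) \<noteq> 0} \<union> add_mset r ` U"
  have "finite {\<alpha>. coeff (p (add_mset r \<alpha>)) (add_mset v M) \<noteq> 0}"
    by (rule finite_vimageI[OF fin[of "add_mset v M"], of "add_mset r", unfolded vimage_def mem_Collect_eq]) (simp add: inj_def)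
  moreover have "finite (\<Union>(N, L) \<in> T. {\<alpha>. coeff (p \<alpha>) L \<noteq> 0})"
    using finT fin by auto
  ultimately have finU: "finite U" unfolding U_def by (rule finite_UnI)
  have finS: "finite S" unfolding S_def by (intro finite_UnI finite_imageI finU fin)
  have deriv_p: "mps_deriv v (p \<alpha>) = of_nat (count \<alpha> r) * (p (\<alpha> - {#r#}) * mps_deriv v (X r))" for \<alpha>
    using mps_deriv_prod_mset[of r v X \<alpha>] 0 by (simp add: p_def mult.assoc)
  have "coeff (mps_deriv v (mps_subst f X)) M
      = of_nat (count M v + 1) * (\<Sum>\<alpha> \<in> S. coeff f \<alpha> * coeff (p \<alpha>) (add_mset v M))"
    unfolding coeff_deriv p_def
    by (subst coeff_subst[OF finS]) (auto simp: S_def p_def)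
  also have "\<dots> = (\<Sum>\<alpha> \<in> S. coeff f \<alpha> * coeff (mps_deriv v (p \<alpha>)) M)"
    by (simp add: sum_distrib_left coeff_deriv ac_simps)
  also have "\<dots> = (\<Sum>\<alpha> \<in> add_mset r ` U. coeff f \<alpha> * coeff (mps_deriv v (p \<alpha>)) M)"
  proof (rule sum.mono_neutral_right[OF finS])
    show "\<forall>\<alpha> \<in> S - add_mset r ` U. coeff f \<alpha> * coeff (mps_deriv v (p \<alpha>)) M = 0"
    proof
      fix \<alpha> assume \<alpha>: "\<alpha> \<in> S - add_mset r ` U"
      have "r \<notin># \<alpha>"
      proof
        assume "r \<in># \<alpha>"
        then obtain \<beta> where "\<alpha> = add_mset r \<beta>" by (metis insert_DiffM)
        with \<alpha> show False by (auto simp: S_def U_def)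
      qed
      thus "coeff f \<alpha> * coeff (mps_deriv v (p \<alpha>)) M = 0"
        by (simp add: deriv_p not_in_iff zero_mps.rep_eq)
    qed
  qed (auto simp: S_def)
  also have "\<dots> = (\<Sum>\<alpha> \<in> U. coeff f (add_mset r \<alpha>) * coeff (mps_deriv v (p (add_mset r \<alpha>))) M)"
    by (subst sum.reindex) (auto simp: inj_on_def)
  also have "\<dots> = (\<Sum>\<alpha> \<in> U. coeff (mps_deriv r f) \<alpha> * coeff (mps_deriv v (X r) * p \<alpha>) M)"
    by (rule sum.cong[OF refl], unfold deriv_p coeff_of_nat_mult) (simp add: coeff_deriv ac_simps)
  also have "\<dots> = (\<Sum>(N, L) \<in> T. coeff (mps_deriv v (X r)) N * (\<Sum>\<alpha> \<in> U. coeff (mps_deriv r f) \<alpha> * coeff (p \<alpha>) L))"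
    unfolding coeff_mult T_def sum_distrib_left case_prod_unfold
    by (subst sum.swap) (simp add: ac_simps)
  also have "\<dots> = (\<Sum>(N, L) \<in> T. coeff (mps_deriv v (X r)) N * coeff (mps_subst (mps_deriv r f) X) L)"
    by (rule sum.cong[OF refl], clarify, unfold p_def, subst coeff_subst[OF finU])
      (auto simp: U_def p_def)
  also have "\<dots> = coeff (mps_deriv v (X r) * mps_subst (mps_deriv r f) X) M"
    by (simp add: coeff_mult T_def)
  finally show "coeff (mps_deriv v (mps_subst f X)) M
      = coeff (mps_deriv v (X r) * mps_subst (mps_deriv r f) X) M" .
qed


lemma coeff_subst_empty:
  assumes "\<And>j. coeff (X j) {#} = 0"
  shows "coeff (mps_subst f X) {#} = coeff f {#}"
proof -
  have "coeff (\<Prod>j \<in># \<alpha>. X j) {#} = 0" if "\<alpha> \<noteq> {#}" for \<alpha>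
    using coeff_prod_mset_size_less[of X "{#}" \<alpha>] assms that by (simp add: nonempty_has_size)
  thus ?thesis by (subst coeff_subst[of "{{#}}"]) (auto simp: one_mps.rep_eq)
qed

subsection \<open>Iterated derivatives\<close>

definition mps_derivs :: "'a multiset \<Rightarrow> ('a, 'k :: comm_ring_1) mps \<Rightarrow> ('a, 'k) mps" where
  "mps_derivs \<gamma> f = fold_mset mps_deriv f \<gamma>"

interpretation mps_deriv: comp_fun_commute mps_deriv
  by unfold_locales (auto simp: fun_eq_iff mps_deriv_commute)

lemma mps_derivs_empty [simp]: "mps_derivs {#} f = f"
  by (simp add: mps_derivs_def)

lemma mps_derivs_add_mset: "mps_derivs (add_mset j \<gamma>) f = mps_deriv j (mps_derivs \<gamma> f)"
  by (simp add: mps_derivs_def)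

lemma mps_derivs_add_mset': "mps_derivs (add_mset j \<gamma>) f = mps_derivs \<gamma> (mps_deriv j f)"
  by (simp add: mps_derivs_def mps_deriv.fold_mset_fun_left_comm)

text \<open>The factorial of a multi-index; for the multiset of subtrees at a vertex it is a part of
  the symmetry factor of the tree.\<close>

definition mset_fact :: "'a multiset \<Rightarrow> nat" where
  "mset_fact M = (\<Prod>x \<in> set_mset M. fact (count M x))"

lemma mset_fact_empty [simp]: "mset_fact {#} = 1"
  by (simp add: mset_fact_def)

lemma mset_fact_pos: "mset_fact M > 0"
  by (simp add: mset_fact_def prod_pos)

lemma mset_fact_add_mset: "mset_fact (add_mset x M) = (count M x + 1) * mset_fact M"
proof -
  have "(\<Prod>y \<in> set_mset M - {x}. fact (count (add_mset x M) y)) = (\<Prod>y \<in> set_mset M - {x}. fact (count M y) :: nat)"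
    by (rule prod.cong) auto
  moreover have "mset_fact M = fact (count M x) * (\<Prod>y \<in> set_mset M - {x}. fact (count M y))"
    unfolding mset_fact_def
    by (cases "x \<in># M") (simp_all add: prod.remove not_in_iff)
  ultimately show ?thesis
    by (simp add: mset_fact_def prod.insert_remove algebra_simps)
qed


subsection \<open>Series in two sets of variables\<close>

text \<open>Monomials in two sets of variables: by \<open>mixed_exhaust\<close> and
  \<open>mixed_inject\<close>, every multiset over the sum type splits uniquely into a left and a
  right part.\<close>

definition mixed :: "'a multiset \<Rightarrow> 'b multiset \<Rightarrow> ('a + 'b) multiset" where
  "mixed P g = image_mset Inl P + image_mset Inr g"

lemma count_mixed [simp]:
  "count (mixed P g) (Inl x) = count P x" "count (mixed P g) (Inr y) = count g y"
proof -
  have "count (image_mset Inr g) (Inl x :: 'a + 'b) = 0" "count (image_mset Inl P) (Inr y :: 'a + 'b) = 0"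
    by (auto simp: count_eq_zero_iff)
  moreover have "count (image_mset Inl P) (Inl x :: 'a + 'b) = count P x" by (induction P) auto
  moreover have "count (image_mset Inr g) (Inr y :: 'a + 'b) = count g y" by (induction g) auto
  ultimately show "count (mixed P g) (Inl x) = count P x" "count (mixed P g) (Inr y) = count g y"
    by (simp_all add: mixed_def)
qed

lemma mixed_inject [simp]: "mixed P g = mixed Q h \<longleftrightarrow> P = Q \<and> g = h"
  by (metis count_mixed multiset_eqI)

lemma mixed_add: "mixed P g + mixed Q h = mixed (P + Q) (g + h)"
  by (simp add: mixed_def)

lemma mixed_empty [simp]: "mixed {#} {#} = {#}"
  by (simp add: mixed_def)

lemma mixed_eq_empty [simp]: "mixed P g = {#} \<longleftrightarrow> P = {#} \<and> g = {#}"
  by (simp add: mixed_def)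

lemma add_mset_mixed:
  "add_mset (Inl x) (mixed P g) = mixed (add_mset x P) g"
  "add_mset (Inr y) (mixed P g) = mixed P (add_mset y g)"
  by (simp_all add: mixed_def)

lemma mixed_exhaust: obtains P g where "M = mixed P g"
proof -
  have "\<exists>P g. M = mixed P g"
  proof (induction M)
    case empty
    show ?case by (metis mixed_empty)
  next
    case (add z M)
    then obtain P g where "M = mixed P g" by blast
    thus ?case by (cases z) (metis add_mset_mixed)+
  qed
  thus ?thesis using that by blast
qed

lemma mps_eqI_mixed: "(\<And>P g. coeff f (mixed P g) = coeff h (mixed P g)) \<Longrightarrow> f = h"
  by (rule mps_eqI) (metis mixed_exhaust)

lemma coeff_mult_mixed:
  "coeff (f * h) (mixed P g) =
     (\<Sum>(P\<^sub>1, P\<^sub>2) \<in> {(A, B). A + B = P}. \<Sum>(g\<^sub>1, g\<^sub>2) \<in> {(A, B). A + B = g}.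
        coeff f (mixed P\<^sub>1 g\<^sub>1) * coeff h (mixed P\<^sub>2 g\<^sub>2))"
proof -
  let ?m = "\<lambda>((P\<^sub>1, P\<^sub>2), (g\<^sub>1, g\<^sub>2)). (mixed P\<^sub>1 g\<^sub>1, mixed P\<^sub>2 g\<^sub>2)"
  let ?S = "{(A, B). A + B = P} \<times> {(A, B). A + B = g}"
  have "{(N, L). N + L = mixed P g} = ?m ` ?S"
  proof
    show "{(N, L). N + L = mixed P g} \<subseteq> ?m ` ?S"
    proof clarify
      fix N L assume NL: "N + L = mixed P g"
      obtain P1 g1 where N: "N = mixed P1 g1" by (rule mixed_exhaust)
      obtain P2 g2 where L: "L = mixed P2 g2" by (rule mixed_exhaust)
      have "((P1, P2), (g1, g2)) \<in> ?S" using NL by (simp add: N L mixed_add)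
      thus "(N, L) \<in> ?m ` ?S" unfolding N L by force
    qed
  qed (auto simp: mixed_add)
  moreover have "inj_on ?m ?S" by (auto simp: inj_on_def)
  ultimately have "coeff (f * h) (mixed P g)
      = (\<Sum>q \<in> ?S. (\<lambda>(N, L). coeff f N * coeff h L) (?m q))"
    by (simp add: coeff_mult sum.reindex)
  also have "\<dots> = (\<Sum>(p, q) \<in> ?S. coeff f (mixed (fst p) (fst q)) * coeff h (mixed (snd p) (snd q)))"
    by (rule sum.cong) auto
  finally show ?thesis by (simp add: sum.cartesian_product case_prod_unfold)
qed

lemma coeff_mult_mixed_nonzero:
  assumes "coeff (f * h) (mixed P g) \<noteq> 0"
  obtains P\<^sub>1 P\<^sub>2 g\<^sub>1 g\<^sub>2 where "P\<^sub>1 + P\<^sub>2 = P" "g\<^sub>1 + g\<^sub>2 = g"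
    "coeff f (mixed P\<^sub>1 g\<^sub>1) \<noteq> 0" "coeff h (mixed P\<^sub>2 g\<^sub>2) \<noteq> 0"
proof -
  obtain q where "q \<in> {(N, L). N + L = mixed P g}" "(case q of (N, L) \<Rightarrow> coeff f N * coeff h L) \<noteq> 0"
    using assms unfolding coeff_mult by (rule sum.not_neutral_contains_not_neutral)
  then obtain N L where NL: "N + L = mixed P g" "coeff f N * coeff h L \<noteq> 0" by (cases q) simp
  obtain P1 g1 where N: "N = mixed P1 g1" by (rule mixed_exhaust)
  obtain P2 g2 where L: "L = mixed P2 g2" by (rule mixed_exhaust)
  have "coeff f N \<noteq> 0" "coeff h L \<noteq> 0" using NL(2) by (metis mult_zero_left, metis mult_zero_right)
  with NL(1) show ?thesis by (intro that) (simp_all add: N L mixed_add)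
qed

text \<open>Embeds the series in the left variables alone; since \<open>mixed\<close> is injective,
  the sum has at most one term.\<close>

definition left_series :: "('a, 'k :: comm_ring_1) mps \<Rightarrow> ('a + 'b, 'k) mps" where
  "left_series c = Abs_mps (\<lambda>M. \<Sum>P \<in> {P. M = mixed P {#}}. coeff c P)"

lemma coeff_left_series: "coeff (left_series c) (mixed P g) = (if g = {#} then coeff c P else 0)"
proof -
  have "{Q. mixed P g = mixed Q {#}} = (if g = {#} then {P} else {})" by auto
  thus ?thesis by (simp add: left_series_def)
qed

lemma coeff_left_series_mult:
  "coeff (left_series c * f) (mixed P g) = (\<Sum>(P\<^sub>1, P\<^sub>2) \<in> {(A, B). A + B = P}. coeff c P\<^sub>1 * coeff f (mixed P\<^sub>2 g))"
proof -
  have "(\<Sum>q \<in> {(A, B). A + B = g}. coeff (left_series c) (mixed P1 (fst q)) * coeff f (mixed P2 (snd q)))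
      = (\<Sum>q \<in> {(A, B). A + B = g}. if q = ({#}, g) then coeff c P1 * coeff f (mixed P2 g) else 0)" for P1 P2
    by (rule sum.cong) (auto simp: coeff_left_series)
  thus ?thesis by (simp add: coeff_mult_mixed case_prod_unfold finite_msplits[unfolded case_prod_unfold])
qed

text \<open>Encodes \<open>id \<otimes> B\<^sub>i\<^sup>+\<close>; as in \<open>graft\<close>, the
  sum has at most one term.\<close>

definition graft_right :: "'i \<Rightarrow> ('a + 'i rtree, 'k :: comm_ring_1) mps \<Rightarrow> ('a + 'i rtree, 'k) mps" where
  "graft_right i Y = Abs_mps (\<lambda>M. \<Sum>(P, g) \<in> {(P, g). M = mixed P {#RNode i g#}}. coeff Y (mixed P g))"

lemma coeff_graft_right:
  "coeff (graft_right i Y) (mixed P {#RNode j g#}) = (if i = j then coeff Y (mixed P g) else 0)"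
proof -
  have "{(Q, h). mixed P {#RNode j g#} = mixed Q {#RNode i h#}} = (if i = j then {(P, g)} else {})" by auto
  thus ?thesis by (simp add: graft_right_def)
qed

lemma coeff_graft_right_0:
  "(\<And>g. h \<noteq> {#RNode i g#}) \<Longrightarrow> coeff (graft_right i Y) (mixed P h) = 0"
  by (simp add: graft_right_def)

lemma graft_right_sum: "graft_right i (\<Sum>x \<in> A. f x) = (\<Sum>x \<in> A. graft_right i (f x))"
proof (rule mps_eqI_mixed)
  fix P h
  show "coeff (graft_right i (\<Sum>x \<in> A. f x)) (mixed P h) = coeff (\<Sum>x \<in> A. graft_right i (f x)) (mixed P h)"
    by (cases "\<exists>g. h = {#RNode i g#}") (auto simp: coeff_graft_right coeff_graft_right_0 coeff_sum)
qed

lemma graft_right_monomial: "graft_right i (monomial (mixed P g)) = monomial (mixed P {#RNode i g#})"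
proof (rule mps_eqI_mixed)
  fix Q h
  show "coeff (graft_right i (monomial (mixed P g))) (mixed Q h) = coeff (monomial (mixed P {#RNode i g#})) (mixed Q h)"
  proof (cases "\<exists>g. h = {#RNode i g#}")
    case True
    then obtain k where "h = {#RNode i k#}" by blast
    thus ?thesis by (cases "k = g") (simp_all add: coeff_graft_right coeff_monomial)
  next
    case False
    hence "h \<noteq> {#RNode i g#}" for g by blast
    thus ?thesis by (simp add: coeff_graft_right_0 coeff_monomial)
  qed
qed

lemma graft_right_0 [simp]: "graft_right i 0 = 0"
  using graft_right_sum[of i "\<lambda>_. 0" "{}"] by simp


subsection \<open>The coproduct as a substitution\<close>

primrec root_label :: "'i rtree \<Rightarrow> 'i" where
  "root_label (RNode i f) = i"

text \<open>
  \<open>cut_series t\<close> encodes the part of \<open>\<Delta>(t)\<close> whose left factor is a product of one-vertex trees: the variable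
  \<open>Inl j\<close> stands for the one-vertex tree \<open>j\<close> in the left factor, and \<open>Inr s\<close> for the tree \<open>s\<close> in the
  right factor.  The recursion is the cocycle property \<open>\<Delta> B\<^sub>i\<^sup>+ = B\<^sub>i\<^sup>+ \<otimes> 1 + (id \<otimes> B\<^sub>i\<^sup>+) \<Delta>\<close>.
\<close>

primrec cut_series :: "'i rtree \<Rightarrow> ('i + 'i rtree, 'k :: comm_ring_1) mps" where
  "cut_series (RNode i f) = (if f = {#} then mps_var (Inl i) else 0)
     + graft_right i (prod_mset (image_mset cut_series f))"

lemma coeff_cut_series:
  fixes f :: "'i forest"
  shows "coeff (cut_series (RNode i f)) (mixed P h) = (if f = {#} \<and> P = {#i#} \<and> h = {#} then 1 else 0)
     + coeff (graft_right i (\<Prod>t \<in># f. cut_series t)) (mixed P h)"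
proof -
  have "{#Inl i#} = mixed {#i#} ({#} :: 'i rtree multiset)"
    by (simp add: mixed_def)
  thus ?thesis by (simp add: coeff_var mps_rep_eqs)
qed

declare cut_series.simps [simp del]

text \<open>Degrees add under products. The claim for the trees of \<open>f\<close> is a hypothesis,
  so that this can serve as the induction step of \<open>cut_series_degree\<close>.\<close>

lemma cut_series_forest_degree:
  assumes "\<And>t P g. t \<in># f \<Longrightarrow> coeff (cut_series t :: ('i + 'i rtree, 'k :: comm_ring_1) mps) (mixed P g) \<noteq> 0 \<Longrightarrow>
      size P + forest_degree g = tree_degree t"
    and "coeff (\<Prod>t \<in># f. cut_series t :: ('i + 'i rtree, 'k) mps) (mixed P g) \<noteq> 0"
  shows "size P + forest_degree g = forest_degree f"
  using assms
proof (induction f arbitrary: P g)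
  case empty
  thus ?case by (auto simp: one_mps.rep_eq split: if_splits)
next
  case (add t f)
  have "coeff (cut_series t * (\<Prod>t \<in># f. cut_series t :: ('i + 'i rtree, 'k) mps)) (mixed P g) \<noteq> 0"
    using add.prems(2) by simp
  then obtain P1 P2 g1 g2 where *: "P1 + P2 = P" "g1 + g2 = g"
      "coeff (cut_series t :: ('i + 'i rtree, 'k) mps) (mixed P1 g1) \<noteq> 0"
      "coeff (\<Prod>t \<in># f. cut_series t :: ('i + 'i rtree, 'k) mps) (mixed P2 g2) \<noteq> 0"
    by (rule coeff_mult_mixed_nonzero)
  have "size P1 + forest_degree g1 = tree_degree t"
    by (rule add.prems(1)[OF _ *(3)]) simp
  moreover have "size P2 + forest_degree g2 = forest_degree f"
    by (rule add.IH[OF add.prems(1) *(4)]) simp_all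
  ultimately show ?case using *(1,2) by auto
qed

text \<open>The coproduct is graded, and a left variable stands for one vertex.\<close>

lemma cut_series_degree:
  assumes "coeff (cut_series t :: ('i + 'i rtree, 'k :: comm_ring_1) mps) (mixed P g) \<noteq> 0"
  shows "size P + forest_degree g = tree_degree t"
  using assms
proof (induction t arbitrary: P g)
  case (RNode i f)
  show ?case
  proof (cases "f = {#} \<and> P = {#i#} \<and> g = {#}")
    case False
    have "coeff (cut_series (RNode i f)) (mixed P g)
        = coeff (graft_right i (\<Prod>t \<in># f. cut_series t :: ('i + 'i rtree, 'k) mps)) (mixed P g)"
      unfolding coeff_cut_series if_not_P[OF False] by (rule add_0_left)
    with RNode.prems have nz: "coeff (graft_right i (\<Prod>t \<in># f. cut_series t :: ('i + 'i rtree, 'k) mps)) (mixed P g) \<noteq> 0"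
      by metis
    have "\<exists>h. g = {#RNode i h#}"
    proof (rule ccontr)
      assume "\<nexists>h. g = {#RNode i h#}"
      hence "coeff (graft_right i (\<Prod>t \<in># f. cut_series t :: ('i + 'i rtree, 'k) mps)) (mixed P g) = 0"
        by (intro coeff_graft_right_0) blast
      with nz show False by (rule notE)
    qed
    then obtain h where g: "g = {#RNode i h#}" by (rule exE)
    hence "coeff (\<Prod>t \<in># f. cut_series t :: ('i + 'i rtree, 'k) mps) (mixed P h) \<noteq> 0"
      using nz by (simp add: coeff_graft_right)
    hence "size P + forest_degree h = forest_degree f"
      by (rule cut_series_forest_degree[rotated]) (use RNode.IH in auto)
    thus ?thesis by (simp add: g tree_degree_RNode)
  qed (simp add: tree_degree_RNode)
qed

lemma prod_cut_series_degree:
  assumes "coeff (\<Prod>t \<in># f. cut_series t :: ('i + 'i rtree, 'k :: comm_ring_1) mps) (mixed P g) \<noteq> 0"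
  shows "size P + forest_degree g = forest_degree f"
  by (rule cut_series_forest_degree[OF _ assms]) (rule cut_series_degree)

text \<open>There are infinitely many tree variables, but by gradedness only the finitely many
  forests of one degree reach a given monomial.\<close>

lemma summable_cut_series:
  "summable_family (cut_series :: 'i :: finite rtree \<Rightarrow> ('i + 'i rtree, 'k :: comm_ring_1) mps)"
  unfolding summable_family_def
proof
  fix M :: "('i + 'i rtree) multiset"
  obtain P g where M: "M = mixed P g" by (rule mixed_exhaust)
  show "finite {\<alpha>. coeff (\<Prod>j \<in># \<alpha>. cut_series j :: ('i + 'i rtree, 'k) mps) M \<noteq> 0}"
    by (rule finite_subset[OF _ finite_forests[of "size P + forest_degree g"]])
      (clarsimp simp: M, drule prod_cut_series_degree, simp)
qed

section \<open>The coproduct of the solution\<close>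

lemma solution_eq: "solution F i = graft i (mps_subst (F i) (solution F))"
  using solution[of F] unfolding is_solution_def by blast

lemma coeff_solution_empty [simp]: "coeff (solution F i) {#} = 0"
  by (subst solution_eq) (simp add: coeff_graft_0)

text \<open>The part of \<open>\<Delta>(X\<^sub>i)\<close> with one-vertex trees on the left:
  substitution extends \<open>cut_series\<close> from trees to series of forests.\<close>

definition cut_solution ::
  "('i :: finite, 'k :: comm_ring_1) sdse \<Rightarrow> 'i \<Rightarrow> ('i + 'i rtree, 'k) mps" where
  "cut_solution F i = mps_subst (solution F i) cut_series"

lemma summable_solution: "summable_family (solution F)"
  by (rule summable_familyI) simp

lemma coeff_cut_solution_empty [simp]:
  fixes F :: "('i :: finite, 'k :: comm_ring_1) sdse"
  shows "coeff (cut_solution F i) {#} = 0"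
proof -
  have "coeff (\<Prod>t \<in># f. cut_series t :: ('i + 'i rtree, 'k) mps) {#} = 0" if "f \<noteq> {#}" for f :: "'i forest"
    using prod_cut_series_degree[of f "{#}" "{#}", where 'k = 'k] size_le_forest_degree[of f] that
    by (auto simp: nonempty_has_size)
  thus ?thesis unfolding cut_solution_def
    by (subst coeff_subst[of "{{#}}"]) auto
qed

lemma summable_cut_solution: "summable_family (cut_solution F)"
  by (rule summable_familyI) simp

text \<open>In the encoding this is \<open>\<Delta>(f(X)) = f(\<Delta>(X))\<close>, from the
  multiplicativity of the coproduct.\<close>

lemma subst_cut_solution: "mps_subst (mps_subst f (solution F)) cut_series = mps_subst f (cut_solution F)"
  using mps_subst_compose[OF summable_solution summable_cut_series, of F f] summable_cut_solution[of F]
  unfolding cut_solution_def[abs_def] by simp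

text \<open>Only trees with root \<open>i\<close> occur in \<open>X\<^sub>i\<close>, and gradedness
  bounds their degree. The bound \<open>n\<close> need not be sharp.\<close>

lemma coeff_cut_solution:
  fixes F :: "('i :: finite, 'k :: comm_ring_1) sdse"
  assumes "size P + forest_degree h \<le> n"
  shows "coeff (cut_solution F i) (mixed P h) = (\<Sum>g \<in> {g. forest_degree g \<le> n}.
      coeff (mps_subst (F i) (solution F)) g * coeff (cut_series (RNode i g)) (mixed P h))"
proof -
  let ?G = "{g :: 'i forest. forest_degree g \<le> n}" and ?T = "\<lambda>g. {#RNode i g#}"
  have "coeff (cut_solution F i) (mixed P h)
      = (\<Sum>f \<in> ?T ` ?G. coeff (solution F i) f * coeff (\<Prod>t \<in># f. cut_series t) (mixed P h))"
    unfolding cut_solution_def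
  proof (rule coeff_subst)
    fix f assume f: "f \<notin> ?T ` ?G"
    show "coeff (solution F i) f * coeff (\<Prod>t \<in># f. cut_series t) (mixed P h) = 0"
    proof (cases "\<exists>g. f = ?T g")
      case True
      then obtain g where g: "f = ?T g" by blast
      have "n < forest_degree g" using f unfolding g by (meson imageI mem_Collect_eq not_less)
      hence "size P + forest_degree h \<noteq> tree_degree (RNode i g)" using assms by (simp add: tree_degree_RNode)
      hence "coeff (cut_series (RNode i g) :: ('i + 'i rtree, 'k) mps) (mixed P h) = 0"
        using cut_series_degree by blast
      thus ?thesis by (simp add: g)
    next
      case False
      thus ?thesis by (subst solution_eq) (simp add: coeff_graft_0)
    qed
  qed (simp add: finite_forests)
  also have "\<dots> = (\<Sum>g \<in> ?G. coeff (solution F i) (?T g) * coeff (\<Prod>t \<in># ?T g. cut_series t) (mixed P h))"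
    by (subst sum.reindex) (auto simp: inj_on_def)
  also have "\<dots> = (\<Sum>g \<in> ?G. coeff (mps_subst (F i) (solution F)) g * coeff (cut_series (RNode i g)) (mixed P h))"
    by (rule sum.cong[OF refl], subst solution_eq) (simp add: coeff_graft)
  finally show ?thesis .
qed

text \<open>The cocycle property applied to
  \<open>X\<^sub>i = B\<^sub>i\<^sup>+(F\<^sub>i(X))\<close>: the summand
  \<open>B\<^sub>i\<^sup>+ \<otimes> 1\<close> has no tree on the right and drops out.\<close>

lemma coeff_cut_solution_tree:
  fixes F :: "('i :: finite, 'k :: comm_ring_1) sdse"
  shows
  "coeff (cut_solution F i) (mixed P {#RNode j g#})
     = (if i = j then coeff (mps_subst (F i) (cut_solution F)) (mixed P g) else 0)"
proof -
  let ?n = "size P + forest_degree {#RNode j g#}"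
  have "coeff (cut_solution F i) (mixed P {#RNode j g#}) = (\<Sum>h \<in> {h. forest_degree h \<le> ?n}.
      coeff (mps_subst (F i) (solution F)) h * (if i = j then coeff (\<Prod>t \<in># h. cut_series t) (mixed P g) else 0))"
    by (subst coeff_cut_solution[OF le_refl]) (simp add: coeff_cut_series coeff_graft_right)
  also have "\<dots> = (if i = j then coeff (mps_subst (mps_subst (F i) (solution F)) cut_series) (mixed P g) else 0)"
  proof -
    have "coeff (\<Prod>t \<in># f. cut_series t :: ('i + 'i rtree, 'k) mps) (mixed P g) = 0"
      if "f \<notin> {h. forest_degree h \<le> ?n}" for f
    proof (rule ccontr)
      assume "coeff (\<Prod>t \<in># f. cut_series t :: ('i + 'i rtree, 'k) mps) (mixed P g) \<noteq> 0"
      hence "size P + forest_degree g = forest_degree f" by (rule prod_cut_series_degree)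
      with that show False by (simp add: tree_degree_RNode)
    qed
    hence "coeff (mps_subst (mps_subst (F i) (solution F)) cut_series) (mixed P g)
        = (\<Sum>h \<in> {h. forest_degree h \<le> ?n}. coeff (mps_subst (F i) (solution F)) h *
            coeff (\<Prod>t \<in># h. cut_series t) (mixed P g))"
      by (intro coeff_subst finite_forests) simp
    thus ?thesis by (cases "i = j") simp_all
  qed
  finally show ?thesis by (simp add: subst_cut_solution)
qed

text \<open>Nothing remains on the right only after the total cut, and its left factor is a
  one-vertex tree only for the leaf \<open>i\<close>.\<close>

lemma coeff_cut_solution_left:
  "coeff (cut_solution F i) (mixed P {#}) = (if P = {#i#} then coeff (F i) {#} else 0)"
proof -
  have "coeff (cut_solution F i) (mixed P {#}) = (\<Sum>h \<in> {h. forest_degree h \<le> size P}.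
      if h = {#} then if P = {#i#} then coeff (mps_subst (F i) (solution F)) h else 0 else 0)"
    by (subst coeff_cut_solution[of _ _ "size P"]) (auto simp: coeff_cut_series coeff_graft_right_0 intro!: sum.cong)
  also have "\<dots> = (if P = {#i#} then coeff (mps_subst (F i) (solution F)) {#} else 0)"
    by (simp add: finite_forests)
  finally show ?thesis by (simp add: coeff_subst_empty)
qed

lemma coeff_cut_solution_forest:
  assumes "size h \<ge> 2"
  shows "coeff (cut_solution F i) (mixed P h) = 0"
proof -
  have "h \<noteq> {#RNode i g#}" "h \<noteq> {#}" for g using assms by auto
  thus ?thesis
    by (subst coeff_cut_solution[OF le_refl]) (auto simp: coeff_cut_series coeff_graft_right_0 intro!: sum.neutral)
qed


subsection \<open>Taylor expansion\<close>

text \<open>The series in the left variables that multiplies \<open>t\<close> on the right of the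
  coproduct; \<open>t\<close> can occur there only in the component of its root label.\<close>

definition right_coeff :: "('i :: finite, 'k :: comm_ring_1) sdse \<Rightarrow> 'i rtree \<Rightarrow> ('i, 'k) mps" where
  "right_coeff F t = Abs_mps (\<lambda>P. coeff (cut_solution F (root_label t)) (mixed P {#t#}))"

lemma coeff_right_coeff: "coeff (right_coeff F t) P = coeff (cut_solution F (root_label t)) (mixed P {#t#})"
  by (simp add: right_coeff_def)

text \<open>The right factors are empty or single trees, so \<open>cut_solution\<close> is affine in
  the tree variables and its derivative is the coefficient series.\<close>

lemma mps_deriv_cut_solution:
  "mps_deriv (Inr t) (cut_solution F i) = (if i = root_label t then left_series (right_coeff F t) else 0)"
proof (rule mps_eqI_mixed)
  fix P g
  have "coeff (mps_deriv (Inr t) (cut_solution F i)) (mixed P g)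
      = of_nat (count g t + 1) * coeff (cut_solution F i) (mixed P (add_mset t g))"
    by (simp add: coeff_deriv add_mset_mixed)
  also have "\<dots> = coeff (if i = root_label t then left_series (right_coeff F t) else 0) (mixed P g)"
  proof (cases "g = {#}")
    case True
    thus ?thesis
      by (cases t) (auto simp: coeff_left_series coeff_right_coeff coeff_cut_solution_tree zero_mps.rep_eq)
  next
    case False
    hence "size (add_mset t g) \<ge> 2" by (cases g) auto
    hence "coeff (cut_solution F i) (mixed P (add_mset t g)) = 0" by (rule coeff_cut_solution_forest)
    thus ?thesis using False by (simp add: coeff_left_series zero_mps.rep_eq)
  qed
  finally show "coeff (mps_deriv (Inr t) (cut_solution F i)) (mixed P g)
    = coeff (if i = root_label t then left_series (right_coeff F t) else 0) (mixed P g)" .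
qed

text \<open>With all tree variables set to 0, the normalization turns
  \<open>cut_solution F j\<close> into the variable \<open>h\<^sub>j\<close>, and the substitution
  becomes the identity.\<close>

lemma coeff_subst_cut_solution_left:
  assumes "\<And>i. coeff (F i) {#} = 1"
  shows "coeff (mps_subst f (cut_solution F)) (mixed P {#}) = coeff f P"
proof -
  have "coeff (\<Prod>j \<in># \<alpha>. cut_solution F j) (mixed P {#}) = (if P = \<alpha> then 1 else 0)" for \<alpha> P
  proof (induction \<alpha> arbitrary: P)
    case empty
    thus ?case by (simp add: one_mps.rep_eq)
  next
    case (add j \<alpha>)
    have "coeff (\<Prod>j \<in># add_mset j \<alpha>. cut_solution F j) (mixed P {#}) =
        (\<Sum>(P\<^sub>1, P\<^sub>2) \<in> {(A, B). A + B = P}. coeff (cut_solution F j) (mixed P\<^sub>1 {#}) * (if P\<^sub>2 = \<alpha> then 1 else 0))"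
      using add by (simp add: coeff_mult_mixed)
    also have "\<dots> = (\<Sum>q \<in> {(A, B). A + B = P}. if q = ({#j#}, \<alpha>) then 1 else 0)"
    proof (rule sum.cong[OF refl])
      fix q assume "q \<in> {(A, B). A + B = P}"
      show "(case q of (P\<^sub>1, P\<^sub>2) \<Rightarrow> coeff (cut_solution F j) (mixed P\<^sub>1 {#}) * (if P\<^sub>2 = \<alpha> then 1 else 0))
          = (if q = ({#j#}, \<alpha>) then 1 else 0)"
        by (cases "fst q = {#j#}"; cases "snd q = \<alpha>")
          (simp_all add: case_prod_unfold coeff_cut_solution_left assms prod_eq_iff)
    qed
    also have "\<dots> = (if P = add_mset j \<alpha> then 1 else 0)"
      by (auto simp: finite_msplits)
    finally show ?case .
  qed
  thus ?thesis by (subst coeff_subst[of "{P}"]) auto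
qed

text \<open>Taylor's formula in the tree variables: one derivative is taken for each tree of
  \<open>g\<close>, and the chain rule turns it into a factor \<open>right_coeff F t\<close> and a
  derivative of \<open>f\<close>.\<close>

lemma coeff_subst_cut_solution:
  assumes "\<And>i. coeff (F i) {#} = 1"
  shows "of_nat (mset_fact g) * coeff (mps_subst f (cut_solution F)) (mixed P g)
    = coeff ((\<Prod>t \<in># g. right_coeff F t) * mps_derivs (image_mset root_label g) f) P"
proof (induction g arbitrary: f P)
  case empty
  thus ?case by (simp add: coeff_subst_cut_solution_left[OF assms])
next
  case (add t g)
  let ?W = "cut_solution F" and ?C = "right_coeff F"
  have "of_nat (mset_fact (add_mset t g)) * coeff (mps_subst f ?W) (mixed P (add_mset t g))
      = of_nat (mset_fact g) * coeff (mps_deriv (Inr t) (mps_subst f ?W)) (mixed P g)"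
    by (simp add: mset_fact_add_mset coeff_deriv add_mset_mixed algebra_simps)
  also have "mps_deriv (Inr t) (mps_subst f ?W)
      = left_series (?C t) * mps_subst (mps_deriv (root_label t) f) ?W"
    using mps_deriv_subst[OF summable_cut_solution, of "root_label t" "Inr t" F f]
    by (simp add: mps_deriv_cut_solution)
  also have "of_nat (mset_fact g) * coeff \<dots> (mixed P g) =
      (\<Sum>(P\<^sub>1, P\<^sub>2) \<in> {(A, B). A + B = P}. coeff (?C t) P\<^sub>1 *
        (of_nat (mset_fact g) * coeff (mps_subst (mps_deriv (root_label t) f) ?W) (mixed P\<^sub>2 g)))"
    by (simp add: coeff_left_series_mult sum_distrib_left case_prod_unfold ac_simps)
  also have "\<dots> = coeff (?C t * ((\<Prod>t \<in># g. ?C t) * mps_derivs (image_mset root_label g) (mps_deriv (root_label t) f))) P"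
    by (subst coeff_mult) (simp only: add)
  finally show ?case
    by (simp add: mps_derivs_add_mset' mult.assoc)
qed

text \<open>The symmetry factor makes \<open>tree_series\<close> a plain product over the vertices.\<close>

primrec tree_symmetry :: "'i rtree \<Rightarrow> nat" where
  "tree_symmetry (RNode i f) = mset_fact f * prod_mset (image_mset tree_symmetry f)"

primrec tree_series :: "('i, 'k :: comm_ring_1) sdse \<Rightarrow> 'i rtree \<Rightarrow> ('i, 'k) mps" where
  "tree_series F (RNode i f) = mps_derivs (image_mset root_label f) (F i) * prod_mset (image_mset (tree_series F) f)"

text \<open>Taylor's formula is applied at every vertex, by induction; each vertex contributes its
  multiset factorial.\<close>

lemma tree_series_eq:
  assumes "\<And>i. coeff (F i) {#} = 1"
  shows "tree_series F t = of_nat (tree_symmetry t) * right_coeff F t"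
proof (induction t)
  case (RNode i f)
  have "of_nat (mset_fact f) * right_coeff F (RNode i f)
      = (\<Prod>t \<in># f. right_coeff F t) * mps_derivs (image_mset root_label f) (F i)"
    by (rule mps_eqI) (simp add: coeff_of_nat_mult coeff_right_coeff coeff_cut_solution_tree
        coeff_subst_cut_solution[OF assms])
  moreover have "(\<Prod>t \<in># f. tree_series F t) = of_nat (\<Prod>t \<in># f. tree_symmetry t) * (\<Prod>t \<in># f. right_coeff F t)"
    using RNode by (induction f) (auto simp: ac_simps)
  ultimately have "tree_series F (RNode i f)
      = of_nat (\<Prod>t \<in># f. tree_symmetry t) * (of_nat (mset_fact f) * right_coeff F (RNode i f))"
    by (simp only: tree_series.simps ac_simps)
  thus ?case by (simp add: ac_simps)
qed


subsection \<open>Admissible cuts\<close>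

text \<open>
  Unlike the admissible cuts, these include the empty cut and the total cut \<open>{[]}\<close> above the root; a cut
  avoiding \<open>[]\<close> then amounts to an independent choice of a cut in every subtree of the root.
\<close>

definition antichain_cuts :: "'i ptree \<Rightarrow> nat list set set" where
  "antichain_cuts p = {c. c \<subseteq> vertices p \<and> (\<forall>u \<in> c. \<forall>v \<in> c. prefix u v \<longrightarrow> u = v)}"

lemma finite_vertices: "finite (vertices p)"
  by (induction p) auto

lemma root_in_vertices [simp]: "[] \<in> vertices p"
  by (cases p) simp

lemma Cons_in_vertices [simp]: "k # v \<in> vertices (PNode i ps) \<longleftrightarrow> k < length ps \<and> v \<in> vertices (ps ! k)"
  by auto

lemma finite_antichain_cuts: "finite (antichain_cuts p)"
  by (rule finite_subset[of _ "Pow (vertices p)"]) (auto simp: antichain_cuts_def finite_vertices)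

lemma antichain_cut_finite: "c \<in> antichain_cuts p \<Longrightarrow> finite c"
  unfolding antichain_cuts_def using finite_vertices finite_subset by blast

text \<open>An extension of \<open>v\<close> of maximal length has no strict extension.\<close>

lemma ex_leaf_below:
  assumes "v \<in> vertices p"
  shows "\<exists>l \<in> leaves p. prefix v l"
proof -
  let ?W = "{w \<in> vertices p. prefix v w}"
  have W: "finite ?W" "?W \<noteq> {}" using finite_vertices[of p] assms by auto
  hence "Max (length ` ?W) \<in> length ` ?W" by (intro Max_in) auto
  then obtain l where l: "l \<in> ?W" "Max (length ` ?W) = length l" by blast
  have l_max: "length w \<le> length l" if "w \<in> ?W" for w
    unfolding l(2)[symmetric] using W that by (intro Max_ge) auto
  have "\<not> strict_prefix l w" if "w \<in> vertices p" for w
  proof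
    assume lw: "strict_prefix l w"
    with l(1) that have "w \<in> ?W" by (auto simp: strict_prefix_def)
    from l_max[OF this] prefix_length_less[OF lw] show False by simp
  qed
  with l(1) show ?thesis by (auto simp: leaves_def)
qed

text \<open>Two comparable edges of a cut would both lie on the path to a leaf below the lower one;
  conversely, all edges on one path are comparable.\<close>

lemma admissible_cuts_eq: "insert {} (admissible_cuts p) = {c \<in> antichain_cuts p. [] \<notin> c}"
proof (intro equalityI subsetI)
  fix c assume "c \<in> insert {} (admissible_cuts p)"
  moreover have "u = v" if c: "c \<in> admissible_cuts p" and uv: "u \<in> c" "v \<in> c" "prefix u v" for u v
  proof -
    have "v \<in> vertices p" using c uv by (auto simp: admissible_cuts_def edges_def)
    then obtain l where l: "l \<in> leaves p" "prefix v l" using ex_leaf_below by blast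
    have "finite c" using c finite_vertices[of p] by (auto simp: admissible_cuts_def edges_def intro: finite_subset)
    moreover have "card {e \<in> c. prefix e l} \<le> 1" using c l(1) by (auto simp: admissible_cuts_def)
    moreover have "prefix u l" using uv(3) l(2) by (rule prefix_order.trans)
    ultimately show ?thesis using uv(1,2) l(2) card_le_Suc0_iff_eq[of "{e \<in> c. prefix e l}"] by auto
  qed
  ultimately show "c \<in> {c \<in> antichain_cuts p. [] \<notin> c}"
    by (auto simp: antichain_cuts_def admissible_cuts_def edges_def)
next
  fix c assume "c \<in> {c \<in> antichain_cuts p. [] \<notin> c}"
  hence c: "c \<in> antichain_cuts p" "[] \<notin> c" by auto
  have "card {e \<in> c. prefix e l} \<le> 1" for l
  proof -
    have "finite {e \<in> c. prefix e l}" using antichain_cut_finite[OF c(1)] by simp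
    moreover have "u = v" if "u \<in> c" "v \<in> c" "prefix u l" "prefix v l" for u v
      using prefix_same_cases[OF that(3,4)] that(1,2) c(1) by (auto simp: antichain_cuts_def)
    ultimately show ?thesis by (auto simp: card_le_Suc0_iff_eq)
  qed
  thus "c \<in> insert {} (admissible_cuts p)"
    using c by (auto simp: admissible_cuts_def antichain_cuts_def edges_def)
qed

lemma antichain_cuts_root:
  assumes "c \<in> antichain_cuts p" "[] \<in> c"
  shows "c = {[]}"
proof -
  have "v = []" if "v \<in> c" for v
  proof -
    have "[] = v" using assms that Nil_prefix[of v] unfolding antichain_cuts_def by blast
    thus ?thesis ..
  qed
  thus ?thesis using assms(2) by blast
qed

lemma antichain_cuts_split: "antichain_cuts p = insert {[]} {c \<in> antichain_cuts p. [] \<notin> c}"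
proof (intro equalityI subsetI)
  fix c assume "c \<in> insert {[]} {c \<in> antichain_cuts p. [] \<notin> c}"
  thus "c \<in> antichain_cuts p" by (auto simp: antichain_cuts_def)
qed (use antichain_cuts_root in blast)

definition glue_cuts :: "nat \<Rightarrow> (nat \<Rightarrow> nat list set) \<Rightarrow> nat list set" where
  "glue_cuts n d = (\<Union>k < n. (#) k ` d k)"

lemma glue_cuts_simps [simp]:
  "[] \<notin> glue_cuts n d" "k # v \<in> glue_cuts n d \<longleftrightarrow> k < n \<and> v \<in> d k"
  by (auto simp: glue_cuts_def)

lemma bij_betw_glue_cuts:
  "bij_betw (glue_cuts (length ps)) (\<Pi>\<^sub>E k \<in> {..<length ps}. antichain_cuts (ps ! k))
     {c \<in> antichain_cuts (PNode i ps). [] \<notin> c}"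
proof (rule bij_betwI)
  let ?n = "length ps"
  let ?D = "\<Pi>\<^sub>E k \<in> {..<?n}. antichain_cuts (ps ! k)"
  let ?C = "{c \<in> antichain_cuts (PNode i ps). [] \<notin> c}"
  let ?g = "\<lambda>c. \<lambda>k \<in> {..<?n}. {v. k # v \<in> c}"
  show "glue_cuts ?n \<in> ?D \<rightarrow> ?C"
  proof
    fix d assume d: "d \<in> ?D"
    have "u = v" if "u \<in> glue_cuts ?n d" "v \<in> glue_cuts ?n d" "prefix u v" for u v
      using that d by (cases u; cases v) (auto simp: PiE_def Pi_def antichain_cuts_def)
    moreover have "u \<in> vertices (PNode i ps)" if "u \<in> glue_cuts ?n d" for u
      using that d by (cases u) (auto simp: PiE_def Pi_def antichain_cuts_def simp del: vertices.simps)
    ultimately show "glue_cuts ?n d \<in> ?C" by (auto simp: antichain_cuts_def simp del: vertices.simps)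
  qed
  show "?g \<in> ?C \<rightarrow> ?D"
  proof
    fix c assume c: "c \<in> ?C"
    have "{v. k # v \<in> c} \<in> antichain_cuts (ps ! k)" if "k < ?n" for k
    proof -
      have "v \<in> vertices (ps ! k)" if "k # v \<in> c" for v
        using c that Cons_in_vertices[of k v i ps] by (auto simp: antichain_cuts_def simp del: vertices.simps Cons_in_vertices)
      moreover have "u = v" if "k # u \<in> c" "k # v \<in> c" "prefix u v" for u v
      proof -
        have "prefix (k # u) (k # v)" using that(3) by simp
        hence "k # u = k # v" using c that(1,2) unfolding antichain_cuts_def by blast
        thus ?thesis by simp
      qed
      ultimately show ?thesis by (auto simp: antichain_cuts_def)
    qed
    thus "?g c \<in> ?D" by (auto simp: PiE_def Pi_def)
  qed
  show "?g (glue_cuts ?n d) = d" if "d \<in> ?D" for d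
    using that by (auto simp: fun_eq_iff PiE_def extensional_def)
  show "glue_cuts ?n (?g c) = c" if c: "c \<in> ?C" for c
  proof (rule set_eqI)
    fix u
    show "u \<in> glue_cuts ?n (?g c) \<longleftrightarrow> u \<in> c"
    proof (cases u)
      case Nil
      thus ?thesis using c by simp
    next
      case (Cons k v)
      have "k < ?n" if "k # v \<in> c"
        using c that Cons_in_vertices[of k v i ps] by (auto simp: antichain_cuts_def simp del: vertices.simps Cons_in_vertices)
      thus ?thesis using Cons by auto
    qed
  qed
qed

section \<open>The contribution of a single cut\<close>

lemma root_component_empty: "root_component p {} = forget_planar p"
proof (induction p)
  case (PNode i ps)
  have "map (\<lambda>k. root_component (ps ! k) {}) [0..<length ps] = map forget_planar ps"
    by (rule nth_equalityI) (auto intro!: PNode)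
  thus ?case by simp
qed

text \<open>\<open>root_component\<close> never looks at the address \<open>[]\<close>; for the
  total cut, the component below \<open>[]\<close> is therefore the whole tree.\<close>

lemma root_component_root: "root_component p {[]} = forget_planar p"
  using root_component_empty[of p] by (cases p) simp

lemma component_Cons: "component (PNode i ps) c (k # v) = component (ps ! k) {w. k # w \<in> c} v"
  by (simp add: component_def)

definition leaf_series :: "'i rtree \<Rightarrow> ('i + 'i rtree, 'k :: comm_ring_1) mps" where
  "leaf_series t = (if t = RNode (root_label t) {#} then mps_var (Inl (root_label t)) else 0)"

text \<open>The term of one cut in \<open>cut_series\<close>: \<open>leaf_series\<close> discards a
  pruned tree with more than one vertex, and after the total cut the right factor is 1.\<close>

definition cut_weight :: "'i ptree \<Rightarrow> nat list set \<Rightarrow> ('i + 'i rtree, 'k :: comm_ring_1) mps" where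
  "cut_weight p c = (\<Prod>v \<in> c. leaf_series (component p c v)) *
     (if [] \<in> c then 1 else mps_var (Inr (root_component p c)))"

lemma cut_weight_root: "cut_weight p {[]} = leaf_series (forget_planar p)"
  by (simp add: cut_weight_def component_def root_component_root)

lemma mps_var_mixed:
  "mps_var (Inl i) = monomial (mixed {#i#} {#})" "mps_var (Inr t) = monomial (mixed {#} {#t#})"
  by (simp_all add: mixed_def monomial_single)

lemma monomial_mixed_mult: "monomial (mixed P g) * monomial (mixed Q h) = monomial (mixed (P + Q) (g + h))"
  by (simp add: mixed_add flip: monomial_add)

text \<open>Allows \<open>graft_right\<close> to pass the left factor, by
  \<open>graft_right_monomial\<close>.\<close>

lemma prod_leaf_series_cases:
  "(\<Prod>x \<in> A. leaf_series (f x)) = (0 :: ('i + 'i rtree, 'k :: comm_ring_1) mps) \<or>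
   (\<exists>P. (\<Prod>x \<in> A. leaf_series (f x)) = (monomial (mixed P {#}) :: ('i + 'i rtree, 'k) mps))"
proof (induction A rule: infinite_finite_induct)
  case (insert x A)
  show ?case
  proof (cases "f x = RNode (root_label (f x)) {#}")
    case True
    have "leaf_series (f x) = (monomial (mixed {#root_label (f x)#} {#}) :: ('i + 'i rtree, 'k) mps)"
      using True by (simp add: leaf_series_def mps_var_mixed)
    with insert show ?thesis
      by (auto simp: monomial_mixed_mult)
  next
    case False
    thus ?thesis using insert by (simp add: leaf_series_def)
  qed
qed (auto intro!: exI[of _ "{#}"] simp: monomial_empty)

text \<open>\<open>Q k\<close> will say that the child \<open>k\<close> is cut off entirely; the
  other children leave a forest to be grafted.\<close>

lemma prod_var_filter:
  "(\<Prod>k < n. if Q k then 1 else mps_var (Inr (r k)))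
     = monomial (mixed {#} (mset (map r (filter (\<lambda>k. \<not> Q k) [0..<n]))))"
proof (induction n)
  case (Suc n)
  show ?case
  proof (cases "Q n")
    case False
    hence "mset (map r (filter (\<lambda>k. \<not> Q k) [0..<Suc n]))
        = mset (map r (filter (\<lambda>k. \<not> Q k) [0..<n])) + {#r n#}" by simp
    thus ?thesis using False
      by (simp only: prod.lessThan_Suc Suc mps_var_mixed(2)[of "r n"] monomial_mixed_mult if_False add_0_left)
  qed (use Suc in simp)
qed (simp add: monomial_empty)

text \<open>The cocycle property for one cut: the pruned parts of the children multiply, and their
  root components are grafted on \<open>i\<close>.\<close>

lemma cut_weight_glue:
  assumes d: "d \<in> (\<Pi>\<^sub>E k \<in> {..<length ps}. antichain_cuts (ps ! k))"
  shows "cut_weight (PNode i ps) (glue_cuts (length ps) d)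
    = graft_right i (\<Prod>k < length ps. cut_weight (ps ! k) (d k) :: ('i + 'i rtree, 'k :: comm_ring_1) mps)"
proof -
  let ?n = "length ps" and ?c = "glue_cuts (length ps) d"
  let ?L = "\<Prod>k < ?n. \<Prod>v \<in> d k. leaf_series (component (ps ! k) (d k) v) :: ('i + 'i rtree, 'k) mps"
  let ?g = "mset (map (\<lambda>k. root_component (ps ! k) (d k)) (filter (\<lambda>k. \<not> [] \<in> d k) [0..<?n]))"
  have fin: "finite (d k)" if "k < ?n" for k
    using that d antichain_cut_finite by (auto simp: PiE_def Pi_def)
  have "(\<Prod>v \<in> ?c. leaf_series (component (PNode i ps) ?c v) :: ('i + 'i rtree, 'k) mps)
      = (\<Prod>k < ?n. \<Prod>v \<in> (#) k ` d k. leaf_series (component (PNode i ps) ?c v))"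
    unfolding glue_cuts_def by (rule prod.UNION_disjoint) (use fin in auto)
  also have "\<dots> = ?L"
    by (rule prod.cong[OF refl]) (simp add: prod.reindex component_Cons)
  finally have L: "(\<Prod>v \<in> ?c. leaf_series (component (PNode i ps) ?c v) :: ('i + 'i rtree, 'k) mps) = ?L" .
  have "map (\<lambda>k. root_component (ps ! k) {v. k # v \<in> ?c}) (filter (\<lambda>k. [k] \<notin> ?c) [0..<?n])
      = map (\<lambda>k. root_component (ps ! k) (d k)) (filter (\<lambda>k. \<not> [] \<in> d k) [0..<?n])"
    by (rule map_cong) (auto intro!: filter_cong)
  hence R: "root_component (PNode i ps) ?c = RNode i ?g" by simp
  have "(\<Prod>k < ?n. cut_weight (ps ! k) (d k) :: ('i + 'i rtree, 'k) mps) = ?L * monomial (mixed {#} ?g)"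
    unfolding cut_weight_def prod.distrib prod_var_filter ..
  moreover have "graft_right i (?L * monomial (mixed {#} ?g)) = ?L * mps_var (Inr (RNode i ?g))"
  proof -
    show ?thesis
      using prod_leaf_series_cases[of "component (PNode i ps) ?c" ?c, where 'k = 'k, unfolded L]
      by (elim disjE exE) (simp_all only: mps_var_mixed mult_zero_left graft_right_0 monomial_mixed_mult
          graft_right_monomial add_0_left add_0_right)
  qed
  ultimately show ?thesis
    unfolding cut_weight_def L R by simp
qed

text \<open>The total cut gives the first summand of the recursion of \<open>cut_series\<close>. The
  other cuts are families of cuts of the children, so their sum factorises.\<close>

lemma sum_cut_weight:
  "(\<Sum>c \<in> antichain_cuts p. cut_weight p c) = (cut_series (forget_planar p) :: ('i + 'i rtree, 'k :: comm_ring_1) mps)"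
proof (induction p)
  case (PNode i ps)
  let ?n = "length ps" and ?D = "\<Pi>\<^sub>E k \<in> {..<length ps}. antichain_cuts (ps ! k)"
  have "(\<Sum>c \<in> {c \<in> antichain_cuts (PNode i ps). [] \<notin> c}. cut_weight (PNode i ps) c :: ('i + 'i rtree, 'k) mps)
      = (\<Sum>d \<in> ?D. cut_weight (PNode i ps) (glue_cuts ?n d))"
    by (rule sum.reindex_bij_betw[OF bij_betw_glue_cuts, symmetric])
  also have "\<dots> = (\<Sum>d \<in> ?D. graft_right i (\<Prod>k < ?n. cut_weight (ps ! k) (d k)))"
    by (rule sum.cong[OF refl cut_weight_glue])
  also have "\<dots> = graft_right i (\<Sum>d \<in> ?D. \<Prod>k < ?n. cut_weight (ps ! k) (d k))"
    by (rule graft_right_sum[symmetric])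
  also have "(\<Sum>d \<in> ?D. \<Prod>k < ?n. cut_weight (ps ! k) (d k) :: ('i + 'i rtree, 'k) mps)
      = (\<Prod>k < ?n. \<Sum>c \<in> antichain_cuts (ps ! k). cut_weight (ps ! k) c)"
    by (rule prod_sum_PiE[symmetric]) (simp_all add: finite_antichain_cuts)
  also have "\<dots> = (\<Prod>k < ?n. cut_series (forget_planar (ps ! k)))"
    by (rule prod.cong[OF refl]) (simp add: PNode)
  also have "\<dots> = prod_list (map cut_series (map forget_planar ps))"
    by (simp add: prod.list_conv_set_nth atLeast0LessThan)
  also have "\<dots> = (\<Prod>t \<in># mset (map forget_planar ps). cut_series t)"
    by (metis mset_map prod_mset_prod_list)
  finally have sum_cuts: "(\<Sum>c \<in> {c \<in> antichain_cuts (PNode i ps). [] \<notin> c}. cut_weight (PNode i ps) c)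
      = (graft_right i (\<Prod>t \<in># mset (map forget_planar ps). cut_series t) :: ('i + 'i rtree, 'k) mps)" .
  have "(\<Sum>c \<in> antichain_cuts (PNode i ps). cut_weight (PNode i ps) c :: ('i + 'i rtree, 'k) mps)
      = cut_weight (PNode i ps) {[]}
        + (\<Sum>c \<in> {c \<in> antichain_cuts (PNode i ps). [] \<notin> c}. cut_weight (PNode i ps) c)"
    by (subst antichain_cuts_split, subst sum.insert) (auto simp: finite_antichain_cuts)
  thus ?case unfolding sum_cuts cut_weight_root by (simp add: cut_series.simps leaf_series_def)
qed

lemma coeff_leaf_series_tree: "coeff (leaf_series t) (mixed P {#s#}) = 0"
  by (simp add: leaf_series_def mps_var_mixed coeff_monomial zero_mps.rep_eq)

lemma coeff_prod_leaf_series: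
  fixes f :: "'i forest"
  shows "coeff ((\<Prod>t \<in># f. leaf_series t) * mps_var (Inr s)) (mixed P {#s'#})
    = (if f = image_mset (\<lambda>j. RNode j {#}) P \<and> s = s' then 1 else 0 :: 'k :: comm_ring_1)"
proof (cases "\<forall>t \<in># f. t = RNode (root_label t) {#}")
  case True
  define Q where "Q = image_mset root_label f"
  have f: "f = image_mset (\<lambda>j. RNode j {#}) Q"
    using True unfolding Q_def by (induction f) auto
  have "(\<Prod>j \<in># Q. leaf_series (RNode j {#})) = (monomial (mixed Q {#}) :: ('i + 'i rtree, 'k) mps)"
  proof (induction Q)
    case (add j Q)
    have "leaf_series (RNode j {#}) = (monomial (mixed {#j#} {#}) :: ('i + 'i rtree, 'k) mps)"
      by (simp add: leaf_series_def mps_var_mixed)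
    with add show ?case by (simp add: monomial_mixed_mult)
  qed (simp add: monomial_empty)
  hence "(\<Prod>t \<in># f. leaf_series t) * mps_var (Inr s) = (monomial (mixed Q {#s#}) :: ('i + 'i rtree, 'k) mps)"
    by (simp add: f image_mset.compositionality comp_def mps_var_mixed monomial_mixed_mult)
  moreover have "f = image_mset (\<lambda>j. RNode j {#}) P \<longleftrightarrow> P = Q"
  proof
    assume "f = image_mset (\<lambda>j. RNode j {#}) P"
    hence "Q = image_mset root_label (image_mset (\<lambda>j. RNode j {#}) P)" unfolding Q_def by (rule arg_cong)
    thus "P = Q" by (simp add: image_mset.compositionality comp_def)
  qed (simp add: f)
  ultimately show ?thesis by (auto simp: coeff_monomial)
next
  case False
  then obtain t where t: "t \<in># f" "t \<noteq> RNode (root_label t) {#}" by blast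
  hence "(\<Prod>t \<in># f. leaf_series t) = (0 :: ('i + 'i rtree, 'k) mps)"
    by (auto dest!: multi_member_split simp: leaf_series_def)
  moreover have "f \<noteq> image_mset (\<lambda>j. RNode j {#}) P" using t by auto
  ultimately show ?thesis by (simp add: zero_mps.rep_eq)
qed

lemma coeff_cut_series_tree:
  "coeff (cut_series (forget_planar p)) (mixed P {#t#}) = (\<Sum>c \<in> insert {} (admissible_cuts p).
     if cut_pruned p c = image_mset (\<lambda>j. RNode j {#}) P \<and> cut_root p c = t then 1 else 0 :: 'k :: comm_ring_1)"
proof -
  let ?C = "{c \<in> antichain_cuts p. [] \<notin> c}"
  have weight: "coeff (cut_weight p c) (mixed P {#t#}) =
      (if cut_pruned p c = image_mset (\<lambda>j. RNode j {#}) P \<and> cut_root p c = t then 1 else 0 :: 'k)" if "c \<in> ?C" for c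
  proof -
    have "(\<Prod>v \<in> c. leaf_series (component p c v))
        = (\<Prod>t \<in># cut_pruned p c. leaf_series t :: ('a + 'a rtree, 'k) mps)"
      by (simp add: prod_unfold_prod_mset cut_pruned_def image_mset.compositionality comp_def)
    moreover have "root_component p c = cut_root p c"
      by (simp add: cut_root_def component_def)
    ultimately show ?thesis using that by (simp add: cut_weight_def coeff_prod_leaf_series)
  qed
  have "coeff (cut_series (forget_planar p)) (mixed P {#t#})
      = (\<Sum>c \<in> insert {[]} ?C. coeff (cut_weight p c) (mixed P {#t#}) :: 'k)"
    unfolding antichain_cuts_split[of p, symmetric] by (simp flip: sum_cut_weight coeff_sum)
  \<comment> \<open>The total cut leaves no tree on the right.\<close>
  also have "\<dots> = (\<Sum>c \<in> ?C. coeff (cut_weight p c) (mixed P {#t#}))"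
    by (subst sum.insert) (auto simp: finite_antichain_cuts cut_weight_root coeff_leaf_series_tree)
  also have "\<dots> = (\<Sum>c \<in> ?C. if cut_pruned p c = image_mset (\<lambda>j. RNode j {#}) P \<and> cut_root p c = t then 1 else 0)"
    by (rule sum.cong[OF refl weight])
  finally show ?thesis unfolding admissible_cuts_eq .
qed

text \<open>Links the encoding to the actual coproduct: \<open>1 \<otimes> s\<close> is the term of
  the empty cut, and \<open>s \<otimes> 1\<close> has no tree on the right.\<close>

lemma lookup_tree_coproduct:
  "Poly_Mapping.lookup (tree_coproduct s) (image_mset (\<lambda>j. RNode j {#}) P, {#t#})
     = (coeff (cut_series s) (mixed P {#t#}) :: 'k :: comm_ring_1)"
proof -
  let ?p = "planar_rep s" and ?l = "image_mset (\<lambda>j. RNode j {#}) P"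
  have fin: "finite (admissible_cuts ?p)"
    by (rule finite_subset[OF _ finite_antichain_cuts[of ?p]]) (use admissible_cuts_eq[of ?p] in blast)
  have "{} \<notin> admissible_cuts ?p" by (simp add: admissible_cuts_def)
  moreover have "cut_pruned ?p {} = {#}" by (simp add: cut_pruned_def)
  moreover have "cut_root ?p {} = s"
    by (simp add: cut_root_def component_def root_component_empty)
  ultimately have "coeff (cut_series s) (mixed P {#t#}) = (if {#} = ?l \<and> s = t then 1 else 0 :: 'k)
      + (\<Sum>c \<in> admissible_cuts ?p. if cut_pruned ?p c = ?l \<and> cut_root ?p c = t then 1 else 0)"
    using coeff_cut_series_tree[of ?p P t, where 'k = 'k] fin by simp
  moreover have "Poly_Mapping.lookup (Poly_Mapping.single (f, {#u#}) 1) (?l, {#t#})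
      = (if f = ?l \<and> u = t then 1 else 0 :: 'k)" for f u
    by (simp add: lookup_single when_def)
  moreover have "Poly_Mapping.lookup (Poly_Mapping.single ({#s#}, {#}) 1) (?l, {#t#}) = (0 :: 'k)"
    by (simp add: lookup_single)
  ultimately show ?thesis
    unfolding tree_coproduct_def by (simp only: lookup_add lookup_sum add_0_left)
qed


subsection \<open>Consequences of the Hopf condition\<close>

lemma lookup_scl: "Poly_Mapping.lookup (scl c x) m = c * Poly_Mapping.lookup x m"
  unfolding scl_def mult_map_scale_conv_mult[symmetric] by (simp add: Poly_Mapping.map.rep_eq when_def)

lemma lookup_lin_ext:
  assumes "finite S" "Poly_Mapping.keys x \<subseteq> S"
  shows "Poly_Mapping.lookup (lin_ext \<phi> x) k
    = (\<Sum>m \<in> S. Poly_Mapping.lookup x m * Poly_Mapping.lookup (\<phi> m) k)"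
proof -
  have "Poly_Mapping.lookup (lin_ext \<phi> x) k
      = (\<Sum>m \<in> Poly_Mapping.keys x. Poly_Mapping.lookup x m * Poly_Mapping.lookup (\<phi> m) k)"
    by (simp add: lin_ext_def lookup_sum lookup_scl)
  also have "\<dots> = (\<Sum>m \<in> S. Poly_Mapping.lookup x m * Poly_Mapping.lookup (\<phi> m) k)"
    by (rule sum.mono_neutral_left) (use assms in \<open>auto simp: in_keys_iff\<close>)
  finally show ?thesis .
qed

lemma lookup_tensor:
  "Poly_Mapping.lookup (tensor a b) (f, g) = Poly_Mapping.lookup a f * Poly_Mapping.lookup b g"
proof -
  have "Poly_Mapping.lookup (lin_ext (\<lambda>h. Poly_Mapping.single (f', h) 1) b) (f, g)
      = (if f' = f then Poly_Mapping.lookup b g else 0)" for f'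
  proof -
    have "Poly_Mapping.lookup (lin_ext (\<lambda>h. Poly_Mapping.single (f', h) 1) b) (f, g)
        = (\<Sum>h \<in> insert g (Poly_Mapping.keys b). if h = g then (if f' = f then Poly_Mapping.lookup b g else 0) else 0)"
    proof (subst lookup_lin_ext[of "insert g (Poly_Mapping.keys b)"], goal_cases)
      case 3
      show ?case
      proof (rule sum.cong[OF refl])
        fix h
        show "Poly_Mapping.lookup b h * Poly_Mapping.lookup (Poly_Mapping.single (f', h) 1) (f, g)
            = (if h = g then (if f' = f then Poly_Mapping.lookup b g else 0) else 0)"
          by (cases "h = g"; cases "f' = f") (simp_all add: lookup_single)
      qed
    qed auto
    thus ?thesis by simp
  qed
  hence "Poly_Mapping.lookup (tensor a b) (f, g) = (\<Sum>f' \<in> insert f (Poly_Mapping.keys a).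
      Poly_Mapping.lookup a f' * (if f' = f then Poly_Mapping.lookup b g else 0))"
    unfolding tensor_def by (subst lookup_lin_ext[of "insert f (Poly_Mapping.keys a)"]) auto
  also have "\<dots> = (\<Sum>f' \<in> insert f (Poly_Mapping.keys a).
      if f' = f then Poly_Mapping.lookup a f * Poly_Mapping.lookup b g else 0)"
    by (rule sum.cong) simp_all
  finally show ?thesis by simp
qed

text \<open>A one-element multiset splits only trivially, so taking the coefficient of a single tree
  is a derivation over the constant term.\<close>

lemma lookup_mult_single_mset:
  fixes x y :: "'a multiset \<Rightarrow>\<^sub>0 'k :: comm_ring_1"
  shows "Poly_Mapping.lookup (x * y) {#t#} = Poly_Mapping.lookup x {#} * Poly_Mapping.lookup y {#t#}
    + Poly_Mapping.lookup x {#t#} * Poly_Mapping.lookup y {#}"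
proof -
  let ?S = "\<lambda>l. Sum_any (\<lambda>q. Poly_Mapping.lookup y q when {#t#} = l + q)"
  have "{l. Poly_Mapping.lookup x l * ?S l \<noteq> 0} \<subseteq> {{#}, {#t#}}"
  proof
    fix l assume "l \<in> {l. Poly_Mapping.lookup x l * ?S l \<noteq> 0}"
    hence "?S l \<noteq> 0" by auto
    then obtain q where "(Poly_Mapping.lookup y q when {#t#} = l + q) \<noteq> 0"
      by (rule Sum_any.not_neutral_obtains_not_neutral)
    hence "{#t#} = l + q" by (auto simp: when_def split: if_splits)
    thus "l \<in> {{#}, {#t#}}" by (auto simp: single_is_union)
  qed
  hence "Sum_any (\<lambda>l. Poly_Mapping.lookup x l * ?S l)
      = (\<Sum>l \<in> {{#}, {#t#}}. Poly_Mapping.lookup x l * ?S l)"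
    by (intro Sum_any.expand_superset) auto
  moreover have "?S {#} = Poly_Mapping.lookup y {#t#}" by simp
  moreover have "?S {#t#} = Poly_Mapping.lookup y {#}" by simp
  ultimately show ?thesis by (simp add: lookup_mult)
qed

text \<open>The factor \<open>c\<close> may depend on the root and the degree but not on the tree.
  The condition describes the single-tree parts possible in the algebra generated by the
  \<open>X\<^sub>i(n)\<close>.\<close>

definition tree_proportional :: "('i :: finite, 'k :: comm_ring_1) sdse \<Rightarrow> ('i rtree \<Rightarrow> 'k) \<Rightarrow> bool" where
  "tree_proportional F \<phi> \<longleftrightarrow> (\<forall>i n. \<exists>c. \<forall>t. root_label t = i \<longrightarrow> tree_degree t = n \<longrightarrow>
     \<phi> t = c * coeff (solution F i) {#t#})"

lemma tree_proportional_0: "tree_proportional F (\<lambda>_. 0)"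
  unfolding tree_proportional_def by (intro allI exI[of _ 0]) simp

lemma tree_proportional_mult:
  assumes "tree_proportional F \<phi>"
  shows "tree_proportional F (\<lambda>t. c * \<phi> t)"
  unfolding tree_proportional_def
proof (intro allI)
  fix i n
  obtain d where "\<forall>t. root_label t = i \<longrightarrow> tree_degree t = n \<longrightarrow> \<phi> t = d * coeff (solution F i) {#t#}"
    using assms unfolding tree_proportional_def by blast
  thus "\<exists>e. \<forall>t. root_label t = i \<longrightarrow> tree_degree t = n \<longrightarrow> c * \<phi> t = e * coeff (solution F i) {#t#}"
    by (intro exI[of _ "c * d"]) (simp add: mult.assoc)
qed

lemma tree_proportional_add:
  assumes "tree_proportional F \<phi>" "tree_proportional F \<psi>"
  shows "tree_proportional F (\<lambda>t. \<phi> t + \<psi> t)"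
  unfolding tree_proportional_def
proof (intro allI)
  fix i n
  obtain d where "\<forall>t. root_label t = i \<longrightarrow> tree_degree t = n \<longrightarrow> \<phi> t = d * coeff (solution F i) {#t#}"
    using assms(1) unfolding tree_proportional_def by blast
  moreover obtain e where "\<forall>t. root_label t = i \<longrightarrow> tree_degree t = n \<longrightarrow> \<psi> t = e * coeff (solution F i) {#t#}"
    using assms(2) unfolding tree_proportional_def by blast
  ultimately show "\<exists>c. \<forall>t. root_label t = i \<longrightarrow> tree_degree t = n \<longrightarrow> \<phi> t + \<psi> t = c * coeff (solution F i) {#t#}"
    by (intro exI[of _ "d + e"]) (simp add: distrib_right)
qed

lemma coeff_solution_wrong_root:
  assumes "root_label t \<noteq> i"
  shows "coeff (solution F i) {#t#} = 0"
  using assms by (subst solution_eq, cases t) (simp add: coeff_graft)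

text \<open>The elements with this property form a subalgebra, because the single-tree part of a
  product is a combination of those of its factors.\<close>

lemma tree_proportional_solution_algebra:
  assumes "x \<in> solution_algebra F"
  shows "tree_proportional F (\<lambda>t. Poly_Mapping.lookup x {#t#})"
proof -
  let ?T = "{x. tree_proportional F (\<lambda>t. Poly_Mapping.lookup x {#t#})}"
  have "subalgebra hull {hom_component n (solution F i) | i n. True} \<subseteq> ?T"
  proof (rule hull_minimal)
    show "{hom_component n (solution F i) | i n. True} \<subseteq> ?T"
    proof clarify
      fix i n
      show "tree_proportional F (\<lambda>t. Poly_Mapping.lookup (hom_component n (solution F i)) {#t#})"
        unfolding tree_proportional_def
      proof (intro allI)
        fix j m
        show "\<exists>c. \<forall>t. root_label t = j \<longrightarrow> tree_degree t = m \<longrightarrow>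
            Poly_Mapping.lookup (hom_component n (solution F i)) {#t#} = c * coeff (solution F j) {#t#}"
          by (rule exI[of _ "if i = j \<and> n = m then 1 else 0"])
            (auto simp: lookup_hom_component coeff_solution_wrong_root)
      qed
    qed
    show "subalgebra ?T"
      unfolding subalgebra_def module.subspace_def[OF module_scl]
    proof (intro conjI ballI allI)
      fix x y assume "x \<in> ?T" "y \<in> ?T"
      hence "tree_proportional F (\<lambda>t. Poly_Mapping.lookup x {#} * Poly_Mapping.lookup y {#t#}
          + Poly_Mapping.lookup y {#} * Poly_Mapping.lookup x {#t#})"
        by (intro tree_proportional_add tree_proportional_mult) simp_all
      thus "x * y \<in> ?T"
        by (simp add: lookup_mult_single_mset mult.commute[of "Poly_Mapping.lookup y {#}"])
    qed (simp_all add: tree_proportional_0 tree_proportional_add tree_proportional_mult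
        lookup_add lookup_scl lookup_one)
  qed
  thus ?thesis using assms unfolding solution_algebra_def by blast
qed

text \<open>For a fixed left forest \<open>f\<close>, a pure tensor gives a multiple of its right
  factor; the rest is linearity.\<close>

lemma tree_proportional_tensor_square:
  assumes "x \<in> tensor_square (solution_algebra F)"
  shows "tree_proportional F (\<lambda>t. Poly_Mapping.lookup x (f, {#t#}))"
  using assms unfolding tensor_square_def
proof (rule module.span_induct[OF module_scl])
  show "module.subspace scl {x. tree_proportional F (\<lambda>t. Poly_Mapping.lookup x (f, {#t#}))}"
    unfolding module.subspace_def[OF module_scl]
    by (auto simp: tree_proportional_0 lookup_add lookup_scl intro!: tree_proportional_add tree_proportional_mult)
qed (auto simp: lookup_tensor intro!: tree_proportional_mult tree_proportional_solution_algebra)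

text \<open>Only the empty cut leaves nothing on the left, and it returns the tree itself.\<close>

lemma coeff_cut_series_right:
  "coeff (cut_series t) (mixed {#} g) = (if g = {#t#} then 1 else 0 :: 'k :: comm_ring_1)"
proof (induction t arbitrary: g)
  case (RNode i f)
  have forest: "coeff (\<Prod>t \<in># f. cut_series t) (mixed {#} g) = (if g = f then 1 else 0 :: 'k)" for g
    using RNode
  proof (induction f arbitrary: g)
    case empty
    thus ?case by (simp add: one_mps.rep_eq)
  next
    case (add t f)
    have "coeff (\<Prod>t \<in># add_mset t f. cut_series t) (mixed {#} g)
        = (\<Sum>(g\<^sub>1, g\<^sub>2) \<in> {(A, B). A + B = g}. coeff (cut_series t) (mixed {#} g\<^sub>1) *
            coeff (\<Prod>t \<in># f. cut_series t) (mixed {#} g\<^sub>2) :: 'k)"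
    proof -
      have "{(A, B). A + B = {#}} = {({#} :: 'a multiset, {#} :: 'a multiset)}" by auto
      thus ?thesis by (simp add: coeff_mult_mixed)
    qed
    also have "\<dots> = (\<Sum>q \<in> {(A, B). A + B = g}. if q = ({#t#}, f) then 1 else 0)"
    proof (rule sum.cong[OF refl])
      fix q
      show "(case q of (g\<^sub>1, g\<^sub>2) \<Rightarrow> coeff (cut_series t) (mixed {#} g\<^sub>1) *
            coeff (\<Prod>t \<in># f. cut_series t) (mixed {#} g\<^sub>2)) = (if q = ({#t#}, f) then 1 else 0 :: 'k)"
        using add.prems[of t] add.IH[OF add.prems]
        by (cases q; cases "fst q = {#t#}"; cases "snd q = f") simp_all
    qed
    also have "\<dots> = (if g = add_mset t f then 1 else 0)"
      by (auto simp: finite_msplits)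
    finally show ?case .
  qed
  show ?case
  proof (cases "\<exists>h. g = {#RNode i h#}")
    case True
    then obtain h where "g = {#RNode i h#}" by blast
    thus ?thesis by (simp add: coeff_cut_series coeff_graft_right forest)
  next
    case False
    hence "g \<noteq> {#RNode i h#}" for h by blast
    thus ?thesis by (simp add: coeff_cut_series coeff_graft_right_0)
  qed
qed

lemma coeff_cut_solution_sum:
  fixes F :: "('i :: finite, 'k :: comm_ring_1) sdse"
  shows "coeff (cut_solution F i) (mixed P g) = (\<Sum>f \<in> {f. forest_degree f = size P + forest_degree g}.
      coeff (solution F i) f * coeff (\<Prod>t \<in># f. cut_series t) (mixed P g))"
  unfolding cut_solution_def
proof (rule coeff_subst)
  show "finite {f :: 'i forest. forest_degree f = size P + forest_degree g}"
    by (rule finite_subset[OF _ finite_forests[of "size P + forest_degree g"]]) auto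
  fix f assume "f \<notin> {f :: 'i forest. forest_degree f = size P + forest_degree g}"
  hence "coeff (\<Prod>t \<in># f. cut_series t :: ('i + 'i rtree, 'k) mps) (mixed P g) = 0"
    using prod_cut_series_degree[of f P g, where 'k = 'k] by fastforce
  thus "coeff (solution F i) f * coeff (\<Prod>t \<in># f. cut_series t) (mixed P g) = 0" by simp
qed

lemma coeff_solution_not_tree: "(\<And>t. f \<noteq> {#t#}) \<Longrightarrow> coeff (solution F i) f = 0"
  by (subst solution_eq) (simp add: coeff_graft_0)

lemma coeff_right_coeff_empty:
  fixes F :: "('i :: finite, 'k :: comm_ring_1) sdse"
  shows "coeff (right_coeff F t) {#} = coeff (solution F (root_label t)) {#t#}"
proof -
  let ?S = "{f :: 'i forest. forest_degree f = size ({#} :: 'i multiset) + forest_degree {#t#}}"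
  have fin: "finite ?S"
    by (rule finite_subset[OF _ finite_forests[of "forest_degree {#t#}"]]) auto
  have "coeff (right_coeff F t) {#} = (\<Sum>f \<in> ?S. if f = {#t#} then coeff (solution F (root_label t)) {#t#} else 0)"
    unfolding coeff_right_coeff coeff_cut_solution_sum
  proof (rule sum.cong[OF refl])
    fix f :: "'i forest"
    show "coeff (solution F (root_label t)) f * coeff (\<Prod>t \<in># f. cut_series t) (mixed {#} {#t#})
        = (if f = {#t#} then coeff (solution F (root_label t)) {#t#} else 0)"
    proof (cases "\<exists>s. f = {#s#}")
      case True
      then obtain s where "f = {#s#}" by blast
      thus ?thesis by (cases "s = t") (simp_all add: coeff_cut_series_right)
    next
      case False
      thus ?thesis by (simp add: coeff_solution_not_tree)
    qed
  qed
  thus ?thesis using fin by simp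
qed

text \<open>By gradedness only this homogeneous component contributes; it consists of single trees,
  to which \<open>lookup_tree_coproduct\<close> applies.\<close>

lemma lookup_coproduct_hom_component:
  fixes F :: "('i :: finite, 'k :: comm_ring_1) sdse"
  assumes "root_label t = i"
  shows "Poly_Mapping.lookup (coproduct (hom_component (size P + tree_degree t) (solution F i)))
      (image_mset (\<lambda>j. RNode j {#}) P, {#t#}) = coeff (right_coeff F t) P"
proof -
  let ?S = "{f :: 'i forest. forest_degree f = size P + forest_degree {#t#}}"
  have fin: "finite ?S"
    by (rule finite_subset[OF _ finite_forests[of "size P + forest_degree {#t#}"]]) auto
  have "Poly_Mapping.lookup (coproduct (hom_component (size P + tree_degree t) (solution F i)))
      (image_mset (\<lambda>j. RNode j {#}) P, {#t#}) =
      (\<Sum>f \<in> ?S. Poly_Mapping.lookup (hom_component (size P + tree_degree t) (solution F i)) f *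
        Poly_Mapping.lookup (\<Prod>s \<in># f. tree_coproduct s) (image_mset (\<lambda>j. RNode j {#}) P, {#t#}))"
    unfolding coproduct_def
    by (rule lookup_lin_ext[OF fin]) (auto simp: in_keys_iff lookup_hom_component split: if_splits)
  also have "\<dots> = (\<Sum>f \<in> ?S. coeff (solution F i) f * coeff (\<Prod>s \<in># f. cut_series s) (mixed P {#t#}))"
  proof (rule sum.cong[OF refl])
    fix f assume f: "f \<in> ?S"
    show "Poly_Mapping.lookup (hom_component (size P + tree_degree t) (solution F i)) f *
        Poly_Mapping.lookup (\<Prod>s \<in># f. tree_coproduct s) (image_mset (\<lambda>j. RNode j {#}) P, {#t#})
        = coeff (solution F i) f * coeff (\<Prod>s \<in># f. cut_series s) (mixed P {#t#})"
    proof (cases "\<exists>s. f = {#s#}")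
      case True
      thus ?thesis using f by (auto simp: lookup_hom_component lookup_tree_coproduct)
    next
      case False
      thus ?thesis using f by (simp add: lookup_hom_component coeff_solution_not_tree)
    qed
  qed
  finally show ?thesis by (simp add: coeff_right_coeff coeff_cut_solution_sum assms)
qed

text \<open>For each \<open>P\<close>, proportionality is applied to the coproduct of
  \<open>X\<^sub>i(size P + n)\<close> at the left factor encoded by \<open>P\<close>; the resulting
  factors are the coefficients of \<open>\<Lambda>\<close>.\<close>

proposition hopf_tree_series:
  fixes F :: "('i :: finite, 'k :: comm_ring_1) sdse"
  assumes normalized: "\<And>i. coeff (F i) {#} = 1" and hopf: "hopf_sdse F"
  shows "\<exists>\<Lambda>. \<forall>t P. root_label t = i \<longrightarrow> tree_degree t = n \<longrightarrow>
    coeff (tree_series F t) P = coeff (tree_series F t) {#} * coeff \<Lambda> P"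
proof -
  have "\<exists>c. \<forall>t. root_label t = i \<longrightarrow> tree_degree t = n \<longrightarrow>
      coeff (right_coeff F t) P = c * coeff (solution F i) {#t#}" for P
  proof -
    let ?x = "hom_component (size P + n) (solution F i)"
    have "?x \<in> solution_algebra F"
      unfolding solution_algebra_def by (rule hull_inc) blast
    hence "coproduct ?x \<in> tensor_square (solution_algebra F)"
      using hopf unfolding hopf_sdse_def hopf_subalgebra_def by blast
    hence "tree_proportional F (\<lambda>t. Poly_Mapping.lookup (coproduct ?x) (image_mset (\<lambda>j. RNode j {#}) P, {#t#}))"
      by (rule tree_proportional_tensor_square)
    then obtain c where "\<forall>t. root_label t = i \<longrightarrow> tree_degree t = n \<longrightarrow>
        Poly_Mapping.lookup (coproduct ?x) (image_mset (\<lambda>j. RNode j {#}) P, {#t#}) = c * coeff (solution F i) {#t#}"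
      unfolding tree_proportional_def by blast
    thus ?thesis using lookup_coproduct_hom_component[of _ i P F] by metis
  qed
  then obtain c where c: "\<And>P t. root_label t = i \<Longrightarrow> tree_degree t = n \<Longrightarrow>
      coeff (right_coeff F t) P = c P * coeff (solution F i) {#t#}" by metis
  have "coeff (tree_series F t) P = coeff (tree_series F t) {#} * coeff (Abs_mps c) P"
    if t: "root_label t = i" "tree_degree t = n" for t P
  proof -
    have series: "coeff (tree_series F t) Q = of_nat (tree_symmetry t) * coeff (right_coeff F t) Q" for Q
      by (simp only: tree_series_eq[OF normalized] coeff_of_nat_mult)
    show ?thesis
      unfolding series c[OF t, of P] coeff_right_coeff_empty t(1) by (simp add: ac_simps)
  qed
  thus ?thesis by blast
qed


subsection \<open>Changes of variables and products of geometric series\<close>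

lemma mps_deriv_0 [simp]: "mps_deriv j 0 = 0"
  by (rule mps_eqI) (simp add: coeff_deriv zero_mps.rep_eq)

lemma mps_derivs_0 [simp]: "mps_derivs \<gamma> 0 = 0"
  by (induction \<gamma>) (simp_all add: mps_derivs_add_mset)

lemma coeff_mps_derivs_empty: "coeff (mps_derivs \<gamma> f) {#} = of_nat (mset_fact \<gamma>) * coeff f \<gamma>"
proof (induction \<gamma> arbitrary: f)
  case (add j \<gamma>)
  show ?case
    by (simp add: mps_derivs_add_mset' add coeff_deriv mset_fact_add_mset algebra_simps)
qed simp

lemma coeff_mps_derivs_single: "coeff (mps_derivs \<gamma> f) {#l#} = coeff (mps_derivs (add_mset l \<gamma>) f) {#}"
  by (simp add: mps_derivs_add_mset coeff_deriv)

lemma coeff_change_variables: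
  fixes F :: "('a, 'k :: comm_ring_1) sdse"
  shows "coeff (change_variables l F i) M = (\<Prod>j \<in># M. l j) * coeff (F i) M"
proof -
  have prod: "(\<Prod>j \<in># \<alpha>. mps_const (l j) * mps_var j) = mps_const (\<Prod>j \<in># \<alpha>. l j) * monomial \<alpha>" for \<alpha>
  proof -
    have const_mult: "mps_const a * mps_const b = mps_const (a * b)" for a b :: 'k
      by (rule mps_eqI) (simp add: coeff_const_mult coeff_const)
    have "(\<Prod>j \<in># \<alpha>. mps_const (l j)) = (mps_const (\<Prod>j \<in># \<alpha>. l j) :: ('a, 'k) mps)"
    proof (induction \<alpha>)
      case empty
      show ?case by (rule mps_eqI) (simp add: coeff_const one_mps.rep_eq)
    qed (simp add: const_mult)
    thus ?thesis by (simp add: prod_mset.distrib prod_mset_var)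
  qed
  have "coeff (change_variables l F i) M = coeff (F i) M * (\<Prod>j \<in># M. l j)"
    unfolding change_variables_def
    by (subst coeff_subst[of "{M}"]) (simp_all add: prod coeff_const_mult coeff_monomial)
  thus ?thesis by (simp only: mult.commute)
qed

lemma mps_deriv_minus: "mps_deriv j (f - g) = mps_deriv j f - mps_deriv j g"
  by (rule mps_eqI) (simp add: coeff_deriv minus_mps.rep_eq right_diff_distrib)

lemma mps_deriv_sum: "mps_deriv j (\<Sum>x \<in> A. f x) = (\<Sum>x \<in> A. mps_deriv j (f x))"
  by (induction A rule: infinite_finite_induct) (simp_all add: mps_deriv_add)

lemma mps_deriv_prod_0:
  assumes "\<And>x. x \<in> A \<Longrightarrow> mps_deriv j (f x) = 0"
  shows "mps_deriv j (\<Prod>x \<in> A. f x) = 0"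
  using assms by (induction A rule: infinite_finite_induct) (simp_all add: mps_deriv_mult)

definition geometric :: "'a set \<Rightarrow> ('a, 'k :: comm_ring_1) mps" where
  "geometric P = mps_inverse (1 - (\<Sum>y \<in> P. mps_var y))"

lemma geometric_mult: "(1 - (\<Sum>y \<in> P. mps_var y)) * geometric P = 1"
  unfolding geometric_def
  by (rule mps_inverse_right) (simp add: minus_mps.rep_eq one_mps.rep_eq coeff_sum coeff_var)

lemma coeff_geometric_empty: "coeff (geometric P :: ('a, 'k :: comm_ring_1) mps) {#} = 1"
proof -
  have "coeff ((1 - (\<Sum>y \<in> P. mps_var y)) * geometric P :: ('a, 'k) mps) {#} = coeff (1 :: ('a, 'k) mps) {#}"
    by (simp only: geometric_mult)
  thus ?thesis by (simp add: minus_mps.rep_eq one_mps.rep_eq coeff_sum coeff_var)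
qed

text \<open>Differentiate \<open>(1 - s) * u = 1\<close> and multiply by \<open>u\<close>.\<close>

lemma mps_deriv_geometric:
  fixes P :: "'a :: finite set"
  shows "mps_deriv j (geometric P) = (if j \<in> P then geometric P * geometric P else 0 :: ('a, 'k :: comm_ring_1) mps)"
proof -
  let ?u = "geometric P :: ('a, 'k) mps" and ?s = "\<Sum>y \<in> P. mps_var y :: ('a, 'k) mps"
  let ?e = "if j \<in> P then 1 else 0 :: ('a, 'k) mps"
  have "mps_deriv j ?s = ?e"
    by (simp add: mps_deriv_sum mps_deriv_var)
  hence "mps_deriv j ((1 - ?s) * ?u) = (1 - ?s) * mps_deriv j ?u - ?e * ?u"
    by (simp add: mps_deriv_mult mps_deriv_minus)
  hence "(1 - ?s) * mps_deriv j ?u = ?e * ?u" by (simp add: geometric_mult)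
  hence "?u * ((1 - ?s) * mps_deriv j ?u) = ?u * (?e * ?u)" by (rule arg_cong)
  moreover have "?u * ((1 - ?s) * mps_deriv j ?u) = mps_deriv j ?u"
    by (simp only: mult.assoc[symmetric] mult.commute[of ?u] geometric_mult mult_1_left)
  ultimately show ?thesis by simp
qed

lemma size_filter_mset_eq_sum: "finite P \<Longrightarrow> size {#m \<in># M. m \<in> P#} = (\<Sum>m \<in> P. count M m)"
proof (induction M)
  case (add x M)
  have "(\<Sum>m \<in> P. count (add_mset x M) m) = (\<Sum>m \<in> P. count M m + (if m = x then 1 else 0))"
    by (rule sum.cong) auto
  thus ?case using add by (simp add: sum.distrib)
qed simp

text \<open>Derived from the differential equation \<open>\<partial>\<^sub>j Q = Q + \<Sum>\<^bsub>m \<in> P\<^esub> h\<^sub>m \<partial>\<^sub>m Q\<close> for \<open>j \<in> P\<close>.\<close>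

lemma coeff_prod_geometric:
  fixes P :: "'b \<Rightarrow> 'a :: finite set"
  assumes S: "finite S" "q \<in> S" and disj: "\<And>p. p \<in> S \<Longrightarrow> p \<noteq> q \<Longrightarrow> P p \<inter> P q = {}" and j: "j \<in> P q"
  defines "Q \<equiv> (\<Prod>p \<in> S. geometric (P p)) :: ('a, 'k :: comm_ring_1) mps"
  shows "of_nat (count M j + 1) * coeff Q (add_mset j M) = of_nat (1 + size {#m \<in># M. m \<in> P q#}) * coeff Q M"
proof -
  let ?u = "geometric (P q) :: ('a, 'k) mps" and ?s = "\<Sum>y \<in> P q. mps_var y :: ('a, 'k) mps"
  define R where "R = (\<Prod>p \<in> S - {q}. geometric (P p) :: ('a, 'k) mps)"
  have Q: "Q = ?u * R" unfolding Q_def R_def by (rule prod.remove[OF S])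
  have deriv: "mps_deriv m Q = ?u * Q" if "m \<in> P q" for m
  proof -
    have "m \<notin> P p" if "p \<in> S - {q}" for p using disj[of p] that \<open>m \<in> P q\<close> by blast
    hence "mps_deriv m R = 0"
      unfolding R_def by (intro mps_deriv_prod_0) (simp add: mps_deriv_geometric)
    thus ?thesis using that by (simp add: Q mps_deriv_mult mps_deriv_geometric mult.assoc)
  qed
  \<comment> \<open>Inserting \<open>u = 1 + s * u\<close> into
    \<open>\<partial>\<^sub>j Q = u * Q\<close> removes the isolated factor \<open>u\<close> and
    yields the differential equation.\<close>
  have "?u - ?s * ?u = 1" using geometric_mult[of "P q"] by (simp only: left_diff_distrib mult_1_left)
  hence "?u * Q = (1 + ?s * ?u) * Q" by (metis diff_eq_eq)
  also have "\<dots> = Q + (\<Sum>m \<in> P q. mps_var m * (?u * Q))"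
    by (simp only: distrib_right mult_1_left sum_distrib_right mult.assoc)
  also have "\<dots> = Q + (\<Sum>m \<in> P q. mps_var m * mps_deriv m Q)"
    by (simp add: deriv)
  finally have eq: "mps_deriv j Q = Q + (\<Sum>m \<in> P q. mps_var m * mps_deriv m Q)"
    by (simp add: deriv[OF j])
  have euler: "coeff (mps_var m * mps_deriv m Q) M = of_nat (count M m) * coeff Q M" for m
  proof (cases "m \<in># M")
    case True
    then obtain N where "M = add_mset m N" by (metis insert_DiffM)
    thus ?thesis by (simp add: coeff_var_mult coeff_deriv)
  next
    case False
    hence "count M m = 0" by (simp add: not_in_iff)
    thus ?thesis by (simp add: coeff_var_mult False)
  qed
  from eq have "coeff (mps_deriv j Q) M = coeff Q M + (\<Sum>m \<in> P q. coeff (mps_var m * mps_deriv m Q) M)"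
    by (simp add: plus_mps.rep_eq coeff_sum)
  also have "(\<Sum>m \<in> P q. coeff (mps_var m * mps_deriv m Q) M) = (\<Sum>m \<in> P q. of_nat (count M m) * coeff Q M)"
    by (rule sum.cong[OF refl euler])
  finally show ?thesis
    by (simp add: coeff_deriv size_filter_mset_eq_sum distrib_right flip: sum_distrib_right)
qed


subsection \<open>Symmetric Hopf systems\<close>

locale symmetric_hopf_sdse =
  fixes F :: "('i :: finite, 'k :: field_char_0) sdse"
  assumes nonconstant: "\<And>i c. F i \<noteq> mps_const c"
    and normalized: "\<And>i. coeff (F i) {#} = 1"
    and connected: "connected_sdse F"
    and symmetric: "symmetric_sdse F"
    and hopf: "hopf_sdse F"
begin

text \<open>Derivatives at the origin instead of coefficients keep factorials out of the tree
  computations.\<close>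

definition d :: "'i \<Rightarrow> 'i multiset \<Rightarrow> 'k" where
  "d i \<gamma> = coeff (mps_derivs \<gamma> (F i)) {#}"

definition A :: "'i \<Rightarrow> 'i \<Rightarrow> 'k" where
  "A i j = coeff (F i) {#j#}"

lemma d_empty [simp]: "d i {#} = 1"
  by (simp add: d_def normalized)

lemma d_single: "d i {#j#} = A i j"
  by (simp add: d_def A_def coeff_mps_derivs_empty mset_fact_add_mset)

section \<open>Logarithmic derivatives of the tree series\<close>

definition ev :: "'i rtree \<Rightarrow> 'k" where
  "ev t = coeff (tree_series F t) {#}"

text \<open>Meaningful for \<open>ev t \<noteq> 0\<close>; otherwise the division by 0 gives
  0.\<close>

definition D :: "'i \<Rightarrow> 'i rtree \<Rightarrow> 'k" where
  "D l t = coeff (tree_series F t) {#l#} / ev t"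

definition \<Lambda> :: "'i \<Rightarrow> nat \<Rightarrow> ('i, 'k) mps" where
  "\<Lambda> i n = (SOME \<Lambda>. \<forall>t P. root_label t = i \<longrightarrow> tree_degree t = n \<longrightarrow>
    coeff (tree_series F t) P = coeff (tree_series F t) {#} * coeff \<Lambda> P)"

lemma coeff_tree_series:
  "coeff (tree_series F t) P = ev t * coeff (\<Lambda> (root_label t) (tree_degree t)) P"
proof -
  have "\<forall>s P. root_label s = root_label t \<longrightarrow> tree_degree s = tree_degree t \<longrightarrow>
      coeff (tree_series F s) P = coeff (tree_series F s) {#} * coeff (\<Lambda> (root_label t) (tree_degree t)) P"
    unfolding \<Lambda>_def by (rule someI_ex) (rule hopf_tree_series[OF normalized hopf])
  thus ?thesis unfolding ev_def by blast
qed

definition L :: "'i \<Rightarrow> nat \<Rightarrow> 'i \<Rightarrow> 'k" where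
  "L i n l = coeff (\<Lambda> i n) {#l#}"

text \<open>The main use of the Hopf condition: two trees with the same root, the same degree and
  nonzero \<open>ev\<close> have the same \<open>D l\<close>, so evaluating both gives a relation
  between the derivatives.\<close>

lemma D_eq_L: "ev t \<noteq> 0 \<Longrightarrow> D l t = L (root_label t) (tree_degree t) l"
  by (simp add: D_def L_def coeff_tree_series)

lemma ev_RNode: "ev (RNode i g) = d i (image_mset root_label g) * (\<Prod>t \<in># g. ev t)"
  by (simp add: ev_def d_def coeff_prod_mset_empty)

lemma coeff_prod_mset_single:
  assumes "\<And>t. t \<in># g \<Longrightarrow> ev t \<noteq> 0"
  shows "coeff (\<Prod>t \<in># g. tree_series F t) {#l#} = (\<Prod>t \<in># g. ev t) * (\<Sum>t \<in># g. D l t)"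
  using assms
proof (induction g)
  case (add t g)
  have "coeff (tree_series F t) {#l#} = ev t * D l t" using add.prems[of t] by (simp add: D_def)
  thus ?case using add
    by (simp add: coeff_mult_single coeff_prod_mset_empty ev_def[symmetric] algebra_simps)
qed (simp add: one_mps.rep_eq)

text \<open>\<open>D l\<close> is a logarithmic derivative, hence additive over the factors of \<open>tree_series\<close>.\<close>

lemma D_RNode:
  assumes "ev (RNode i g) \<noteq> 0"
  shows "D l (RNode i g) = d i (add_mset l (image_mset root_label g)) / d i (image_mset root_label g) + (\<Sum>t \<in># g. D l t)"
proof -
  have nz: "d i (image_mset root_label g) \<noteq> 0" "(\<Prod>t \<in># g. ev t) \<noteq> 0"
    using assms by (auto simp: ev_RNode)
  hence "\<And>t. t \<in># g \<Longrightarrow> ev t \<noteq> 0" by (auto simp: prod_mset_zero_iff)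
  hence "coeff (tree_series F (RNode i g)) {#l#} =
      d i (add_mset l (image_mset root_label g)) * (\<Prod>t \<in># g. ev t)
      + d i (image_mset root_label g) * ((\<Prod>t \<in># g. ev t) * (\<Sum>t \<in># g. D l t))"
    by (simp add: coeff_mult_single coeff_prod_mset_single coeff_mps_derivs_single coeff_prod_mset_empty
        d_def ev_def[symmetric])
  thus ?thesis using nz unfolding D_def[of l "RNode i g"] ev_RNode by (simp add: field_simps)
qed

abbreviation leaf :: "'i \<Rightarrow> 'i rtree" where
  "leaf j \<equiv> RNode j {#}"

lemma ev_leaf [simp]: "ev (leaf j) = 1"
  by (simp add: ev_RNode)

lemma D_leaf [simp]: "D l (leaf j) = A j l"
  by (subst D_RNode) (simp_all add: d_single)

section \<open>The graph and the linear parts\<close>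

definition adj :: "'i \<Rightarrow> 'i \<Rightarrow> bool" where
  "adj i j \<longleftrightarrow> dependency F i j"

lemma adj_irrefl [simp]: "\<not> adj i i"
  using symmetric unfolding adj_def symmetric_sdse_def by blast

lemma adj_sym: "adj i j \<longleftrightarrow> adj j i"
  using symmetric unfolding adj_def symmetric_sdse_def by metis

lemma d_not_adj:
  assumes "\<not> adj i j" "j \<in># \<gamma>"
  shows "d i \<gamma> = 0"
proof -
  obtain \<gamma>' where "\<gamma> = add_mset j \<gamma>'" using assms(2) by (metis insert_DiffM)
  thus ?thesis using assms(1)
    by (simp add: d_def mps_derivs_add_mset' adj_def dependency_def zero_mps.rep_eq)
qed

text \<open>The tree with root \<open>i\<close> and a single leaf \<open>j\<close> has series \<open>\<partial>\<^sub>j F\<^sub>i \<cdot> F\<^sub>j\<close>.\<close>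

lemma adj_iff: "adj i j \<longleftrightarrow> A i j \<noteq> 0"
proof
  assume "adj i j"
  show "A i j \<noteq> 0"
  proof
    assume "A i j = 0"
    hence "ev (RNode i {#leaf j#}) = 0" by (simp add: ev_RNode d_single)
    \<comment> \<open>The whole series is proportional to its constant term, so it vanishes with
      it.\<close>
    hence "tree_series F (RNode i {#leaf j#}) = 0"
      by (intro mps_eqI) (simp add: coeff_tree_series zero_mps.rep_eq del: tree_series.simps)
    hence "mps_deriv j (F i) * F j = 0" by (simp add: mps_derivs_add_mset)
    hence "mps_deriv j (F i) * F j * mps_inverse (F j) = 0" by simp
    hence "mps_deriv j (F i) = 0"
      by (simp only: mult.assoc mps_inverse_right[OF normalized] mult_1_right)
    with \<open>adj i j\<close> show False by (simp add: adj_def dependency_def)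
  qed
next
  assume "A i j \<noteq> 0"
  hence "coeff (mps_deriv j (F i)) {#} \<noteq> 0" by (simp add: coeff_deriv A_def)
  thus "adj i j" by (auto simp: adj_def dependency_def zero_mps.rep_eq)
qed

text \<open>If all partial derivatives of \<open>F i\<close> vanished, characteristic 0 would force
  \<open>F i = 1\<close>.\<close>

lemma ex_adj: "\<exists>j. adj i j"
proof (rule ccontr)
  assume "\<nexists>j. adj i j"
  hence deriv: "mps_deriv j (F i) = 0" for j by (simp add: adj_def dependency_def)
  have "coeff (F i) M = coeff (mps_const 1) M" for M
  proof (cases M)
    case empty
    thus ?thesis by (simp add: normalized coeff_const)
  next
    case (add j N)
    have "coeff (mps_deriv j (F i)) N = 0" by (simp add: deriv zero_mps.rep_eq)
    hence "(of_nat (count N j + 1) :: 'k) * coeff (F i) M = 0" unfolding coeff_deriv add .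
    hence "coeff (F i) M = 0" by (metis mult_eq_0_iff of_nat_eq_0_iff add_is_0 one_neq_zero)
    thus ?thesis by (simp add: coeff_const add)
  qed
  hence "F i = mps_const 1" by (rule mps_eqI)
  with nonconstant show False by blast
qed

text \<open>Evaluates \<open>L i 2 l\<close> on the tree with root \<open>i\<close> and one leaf
  \<open>j\<close>.\<close>

lemma d_pair:
  assumes "adj i j"
  shows "d i {#l, j#} = A i j * (L i 2 l - A j l)"
proof -
  have nz: "A i j \<noteq> 0" using assms by (simp add: adj_iff)
  let ?t = "RNode i {#leaf j#}"
  have ev: "ev ?t \<noteq> 0" using nz by (simp add: ev_RNode d_single)
  have "L i 2 l = D l ?t" using D_eq_L[OF ev] by (simp add: tree_degree_RNode numeral_2_eq_2)
  also have "\<dots> = d i {#l, j#} / A i j + A j l" using D_RNode[OF ev] by (simp add: d_single)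
  finally show ?thesis using nz by (simp add: field_simps)
qed

text \<open>\<open>F\<^sub>i\<close> does not involve \<open>h\<^sub>l\<close>, so
  \<open>d_pair\<close> has left side 0. All neighbours \<open>j\<close> of \<open>i\<close> thus
  have the same linear coefficient at \<open>l\<close>.\<close>

lemma A_not_adj: "adj i j \<Longrightarrow> \<not> adj i l \<Longrightarrow> A j l = L i 2 l"
  using d_pair[of i j l] d_not_adj[of i l "{#l, j#}"] by (simp add: adj_iff)

text \<open>The case \<open>l = i\<close> of \<open>A_not_adj\<close>: the common coefficient of
  \<open>h\<^sub>i\<close> in its neighbours' series, to be rescaled to 1.\<close>

definition b :: "'i \<Rightarrow> 'k" where
  "b i = L i 2 i"

lemma A_eq: "A j i = (if adj j i then b i else 0)"
  using A_not_adj[of i j i] adj_sym[of j i] adj_iff[of j i] by (cases "adj j i") (simp_all add: b_def)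

lemma b_nonzero [simp]: "b i \<noteq> 0"
proof -
  obtain j where "adj i j" using ex_adj by blast
  hence "adj j i" by (simp add: adj_sym)
  thus ?thesis using A_eq[of j i] adj_iff[of j i] by metis
qed

text \<open>If \<open>x\<close> and \<open>z\<close> are not adjacent but have a common neighbour,
  \<open>A_not_adj\<close> makes every neighbour of \<open>x\<close> a neighbour of
  \<open>z\<close>. Along a path this spreads to all vertices: non-adjacency is an equivalence
  relation, so the graph is complete multipartite.\<close>

lemma adj_cases:
  "adj x y \<or> (\<forall>z. adj x z \<longleftrightarrow> adj y z)"
proof -
  have step: "adj z w" if "\<not> adj x z" "adj x y" "adj z y" "adj x w" for x y z w
  proof -
    have "A y z = A w z" using A_not_adj[OF that(2,1)] A_not_adj[OF that(4,1)] by simp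
    thus ?thesis using that(3) by (metis adj_iff adj_sym)
  qed
  have "(\<lambda>x y. dependency F x y \<or> dependency F y x)\<^sup>*\<^sup>* x y"
    using connected unfolding connected_sdse_def by blast
  thus ?thesis
  proof (induction rule: rtranclp_induct)
    case (step y z)
    hence yz: "adj y z" "adj z y" by (auto simp: adj_def[symmetric] adj_sym)
    show ?case
    proof (cases "adj x z")
      case False
      \<comment> \<open>If \<open>x\<close> and \<open>y\<close> had the same neighbours,
        \<open>z\<close> would be adjacent to \<open>x\<close>; so \<open>y\<close> is a common
        neighbour of \<open>x\<close> and \<open>z\<close>.\<close>
      hence xy: "adj x y" using step.IH yz(1) by blast
      have zx: "\<not> adj z x" using False by (simp add: adj_sym)
      have "adj x w \<longleftrightarrow> adj z w" for w
        using \<open>\<And>x y z w. \<not> adj x z \<Longrightarrow> adj x y \<Longrightarrow> adj z y \<Longrightarrow> adj x w \<Longrightarrow> adj z w\<close> False zx xy yz(2) by blast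
      thus ?thesis by blast
    qed simp
  qed simp
qed

section \<open>Second derivatives\<close>

definition \<beta> :: "'i \<Rightarrow> 'k" where
  "\<beta> i = L i 2 (SOME j. adj i j) / b (SOME j. adj i j)"

text \<open>Second derivatives commute: reading \<open>d_pair\<close> in both orders shows that
  \<open>L i 2 l / b l\<close> is the same for all neighbours \<open>l\<close> of \<open>i\<close>,
  so the choice in \<open>\<beta>\<close> is immaterial.\<close>

lemma L_2:
  assumes "adj i l"
  shows "L i 2 l = \<beta> i * b l"
proof -
  define j where "j = (SOME j. adj i j)"
  have j: "adj i j" unfolding j_def using ex_adj by (rule someI_ex)
  have "A i j * (L i 2 l - A j l) = A i l * (L i 2 j - A l j)"
    using d_pair[OF j, of l] d_pair[OF assms, of j] by (simp add: add_mset_commute)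
  hence "b j * L i 2 l = b l * L i 2 j"
    using j assms adj_sym[of j l] by (auto simp: A_eq algebra_simps split: if_splits)
  hence "L i 2 l = b l * L i 2 j / b j" by (metis b_nonzero nonzero_mult_div_cancel_left)
  thus ?thesis unfolding \<beta>_def j_def[symmetric] by simp
qed

lemma d_2:
  assumes "adj i l" "adj i j"
  shows "d i {#l, j#} = b j * b l * (\<beta> i - (if adj j l then 1 else 0))"
  using d_pair[OF assms(2), of l] assms by (cases "adj j l") (simp_all add: A_eq L_2 algebra_simps)

section \<open>Chains and the possible values of \<open>\<beta>\<close>\<close>

primrec chain :: "nat \<Rightarrow> 'i \<Rightarrow> 'i \<Rightarrow> 'i rtree" where
  "chain 0 i j = leaf i"
| "chain (Suc n) i j = RNode i {#chain n j i#}"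

lemma chain_simps [simp]: "root_label (chain n i j) = i" "tree_degree (chain n i j) = Suc n"
  by (induction n arbitrary: i j) (auto simp: tree_degree_RNode)

text \<open>Provides, in every degree, a tree on which \<open>L i n\<close> can be
  evaluated.\<close>

lemma ev_chain:
  assumes "adj i j"
  shows "ev (chain n i j) \<noteq> 0"
  using assms
proof (induction n arbitrary: i j)
  case (Suc n)
  have "adj j i" using Suc.prems by (rule adj_sym[THEN iffD1])
  hence "ev (chain n j i) \<noteq> 0" by (rule Suc.IH)
  moreover have "A i j \<noteq> 0" using Suc.prems by (rule adj_iff[THEN iffD1])
  ultimately show ?case by (simp add: ev_RNode d_single)
qed simp

lemma D_chain_Suc:
  assumes "adj i j"
  shows "D l (chain (Suc n) i j) = d i {#l, j#} / b j + D l (chain n j i)"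
  using D_RNode[of i "{#chain n j i#}" l] ev_chain[OF assms, of "Suc n"] assms
  by (simp add: d_single A_eq)

lemma D_chain_root:
  assumes "adj i j"
  shows "D j (chain (Suc n) i j) = \<beta> i * b j + D j (chain n j i)"
  using assms by (simp only: D_chain_Suc d_2) simp

text \<open>There are no loops, so a vertex \<open>j\<close> contributes nothing in the direction
  \<open>h\<^sub>j\<close>.\<close>

lemma D_chain_nonroot:
  assumes "adj i j"
  shows "D j (chain (Suc n) j i) = D j (chain n i j)"
  using assms D_chain_Suc[of j i j n] d_not_adj[of j j "{#j, i#}"] by (simp add: adj_sym)

lemma L_chain: "adj i j \<Longrightarrow> L i (Suc n) l = D l (chain n i j)"
  using D_eq_L[OF ev_chain] by simp

text \<open>In the chain \<open>i - j - i\<close> the root contributes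
  \<open>\<beta> i * b j\<close> and the leaf \<open>b j\<close>.\<close>

lemma L_3: "adj i j \<Longrightarrow> L i 3 j = \<beta> i * b j + b j"
  using L_chain[of i j 2 j] D_chain_root[of i j 1] D_chain_nonroot[of i j 0]
  by (simp add: numeral_eq_Suc A_eq)

text \<open>In the chain \<open>i - j - i - j\<close> both vertices \<open>i\<close> have a child
  and contribute \<open>\<beta> i * b j\<close> each.\<close>

lemma L_4: "adj i j \<Longrightarrow> L i 4 j = 2 * \<beta> i * b j"
  using L_chain[of i j 3 j] D_chain_root[of i j 2] D_chain_nonroot[of i j 1] D_chain_root[of i j 0]
  by (simp add: numeral_eq_Suc A_eq)

text \<open>A vertex \<open>i\<close> with a child adds \<open>2 * b j\<close> and a final leaf
  \<open>i\<close> adds \<open>b j\<close>: in total \<open>b j\<close> per vertex. The induction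
  needs both alternating chains.\<close>

lemma L_of_beta_2:
  assumes "adj i j" "\<beta> i = 2"
  shows "L i (Suc n) j = of_nat (Suc n) * b j"
proof -
  have "D j (chain n i j) = of_nat (Suc n) * b j \<and> D j (chain n j i) = of_nat n * b j"
  proof (induction n)
    case 0
    thus ?case using assms(1) by (simp add: A_eq)
  next
    case (Suc n)
    thus ?case
      unfolding D_chain_root[OF assms(1)] D_chain_nonroot[OF assms(1)] by (simp add: assms(2) algebra_simps)
  qed
  thus ?thesis using L_chain[OF assms(1)] by simp
qed

text \<open>Comparing \<open>i(j(i, i))\<close> with the chain \<open>i - j - i - j\<close> gives
  \<open>\<beta> i + 2 = 2 * \<beta> i\<close>. The condition on \<open>\<beta> j\<close> makes
  \<open>ev\<close> of the first tree nonzero.\<close>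

lemma beta_neighbour:
  assumes ij: "adj i j" and "\<beta> j \<noteq> 0"
  shows "\<beta> i = 2"
proof -
  let ?s = "RNode j {#leaf i, leaf i#}" and ?t = "RNode i {#RNode j {#leaf i, leaf i#}#}"
  have ji: "adj j i" using ij by (simp add: adj_sym)
  have dj: "d j {#i, i#} \<noteq> 0" using assms d_2[OF ji ji] by simp
  have s: "ev ?s \<noteq> 0" using dj by (simp add: ev_RNode)
  have t: "ev ?t \<noteq> 0" using dj ij by (simp add: ev_RNode d_single adj_iff)
  have "D j ?s = 2 * b j"
    using D_RNode[OF s, of j] d_not_adj[of j j "{#j, i, i#}"] ij by (simp add: A_eq)
  hence "D j ?t = \<beta> i * b j + 2 * b j"
    using D_RNode[OF t, of j] ij by (simp add: d_single A_eq d_2)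
  moreover have "D j ?t = L i 4 j"
    using D_eq_L[OF t, of j] by (simp add: tree_degree_RNode numeral_eq_Suc)
  ultimately show ?thesis using L_4[OF ij] by (simp add: algebra_simps)
qed

text \<open>The chains \<open>i - j - i\<close> and \<open>i - k - i\<close> give
  \<open>\<beta> i + 1 = (\<beta> i - 1) + (\<beta> k - 1) + 1\<close>.\<close>

lemma beta_triangle:
  assumes "adj i j" "adj i k" "adj k j"
  shows "\<beta> k = 2"
proof -
  have "L i 3 j = D j (chain 2 i k)"
    using L_chain[OF assms(2), of 2 j] by (simp add: numeral_eq_Suc)
  also have "\<dots> = d i {#j, k#} / b k + D j (chain 1 k i)"
    using D_chain_Suc[OF assms(2), of j 1] by (simp add: numeral_eq_Suc)
  also have "D j (chain 1 k i) = d k {#j, i#} / b i + b j"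
    using D_chain_Suc[of k i j 0] assms by (simp add: A_eq adj_sym)
  also have "d k {#j, i#} / b i = b j * (\<beta> k - 1)"
    using d_2[of k j i] assms by (simp add: adj_sym[of k i])
  also have "d i {#j, k#} / b k = b j * (\<beta> i - 1)"
    using d_2[of i j k] assms by simp
  finally have "b j * (\<beta> k - 2) = 0"
    using L_3[OF assms(1)] by (simp add: algebra_simps)
  thus ?thesis by simp
qed

text \<open>From a vertex with nonzero \<open>\<beta>\<close>, going to a neighbour and back gives
  the value 2, which then spreads along the edges of the connected graph.\<close>

lemma beta_dichotomy: "(\<forall>i. \<beta> i = 2) \<or> (\<forall>i. \<beta> i = 0)"
proof (cases "\<forall>i. \<beta> i = 0")
  case False
  then obtain x where x: "\<beta> x \<noteq> 0" by blast
  obtain w where "adj x w" using ex_adj by blast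
  hence "\<beta> w = 2" using beta_neighbour[of w x] x by (simp add: adj_sym)
  hence x2: "\<beta> x = 2" using beta_neighbour[OF \<open>adj x w\<close>] by simp
  have "\<beta> y = 2" for y
  proof -
    have "(\<lambda>x y. dependency F x y \<or> dependency F y x)\<^sup>*\<^sup>* x y"
      using connected unfolding connected_sdse_def by blast
    thus ?thesis
    proof (induction rule: rtranclp_induct)
      case (step y z)
      hence "adj z y" by (auto simp: adj_def[symmetric] adj_sym)
      thus ?case using step.IH by (intro beta_neighbour[of z y]) simp_all
    qed (rule x2)
  qed
  thus ?thesis by blast
qed simp

text \<open>Taken from the corolla with root \<open>i\<close> and leaves \<open>\<gamma>\<close>.
  Coefficients are compared without dividing by \<open>ev\<close>, which covers the case
  \<open>d i \<gamma> = 0\<close>.\<close>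

lemma d_add_mset: "d i (add_mset l \<gamma>) = d i \<gamma> * (L i (Suc (size \<gamma>)) l - (\<Sum>m \<in># \<gamma>. A m l))"
proof -
  let ?t = "RNode i (image_mset leaf \<gamma>)"
  have "tree_degree ?t = Suc (size \<gamma>)"
    by (induction \<gamma>) (simp_all add: tree_degree_RNode)
  moreover have "image_mset root_label (image_mset leaf \<gamma>) = \<gamma>"
    by (simp add: image_mset.compositionality comp_def)
  moreover have "(\<Prod>t \<in># image_mset leaf \<gamma>. ev t) = 1" by (simp add: image_mset.compositionality comp_def)
  moreover have "coeff (\<Prod>t \<in># image_mset leaf \<gamma>. tree_series F t) {#l#} = (\<Sum>m \<in># \<gamma>. A m l)"
    by (subst coeff_prod_mset_single) (auto simp: image_mset.compositionality comp_def)
  moreover have "coeff (\<Prod>t \<in># image_mset leaf \<gamma>. tree_series F t) {#} = 1"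
    by (simp add: coeff_prod_mset_empty image_mset.compositionality comp_def ev_def[symmetric] normalized)
  ultimately have "d i (add_mset l \<gamma>) + d i \<gamma> * (\<Sum>m \<in># \<gamma>. A m l) = d i \<gamma> * L i (Suc (size \<gamma>)) l"
    using coeff_tree_series[of ?t "{#l#}"]
    by (simp add: coeff_mult_single coeff_mps_derivs_single d_def[symmetric] L_def ev_RNode)
  thus ?thesis by (simp add: algebra_simps)
qed

section \<open>The series of the system in the two cases\<close>

lemma coeff_F: "of_nat (mset_fact M) * coeff (F i) M = d i M"
  by (simp add: d_def coeff_mps_derivs_empty)

lemma two_multicyclic_if_beta_0:
  assumes "\<And>i. \<beta> i = 0"
  shows "two_multicyclic F"
proof -
  have no_triangle: "\<not> (adj i j \<and> adj i k \<and> adj k j)" for i j k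
    using beta_triangle[of i j k] assms[of k] by auto
  \<comment> \<open>Two neighbours of \<open>i\<close> are not adjacent, so \<open>d_2\<close>
    reduces to the factor \<open>\<beta> i = 0\<close>.\<close>
  have d2: "d i {#l, j#} = 0" for i l j
    using d_not_adj[of i l "{#l, j#}"] d_not_adj[of i j "{#l, j#}"] d_2[of i l j] no_triangle[of i l j] assms
    by (cases "adj i l"; cases "adj i j") auto
  \<comment> \<open>By the corolla recurrence, a vanishing derivative makes all further ones
    vanish.\<close>
  have d_ge2: "d i (add_mset l (add_mset j \<gamma>)) = 0" for i l j \<gamma>
  proof (induction \<gamma>)
    case (add m \<gamma>)
    hence "d i (add_mset m (add_mset l (add_mset j \<gamma>))) = 0" by (subst d_add_mset) simp
    thus ?case by (simp add: add_mset_commute)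
  qed (simp add: d2)
  have F2: "coeff (F i) M = 0" if M2: "size M \<ge> 2" for i M
  proof -
    obtain l N where M: "M = add_mset l N" using M2 by (cases M) auto
    have "N \<noteq> {#}" using M2 by (auto simp: M)
    then obtain j \<gamma> where N: "N = add_mset j \<gamma>" by (cases N) auto
    have "of_nat (mset_fact M) * coeff (F i) M = 0" by (simp only: coeff_F M N d_ge2)
    thus ?thesis using mset_fact_pos[of M] by simp
  qed
  \<comment> \<open>This rescaling turns every nonzero \<open>A i j\<close> into 1.\<close>
  define l where "l j = inverse (b j)" for j
  have eq: "change_variables l F i = 1 + (\<Sum>y \<in> I. mps_var y)" if I: "I = {y. adj i y}" for i I
  proof (rule mps_eqI)
    fix M
    show "coeff (change_variables l F i) M = coeff (1 + (\<Sum>y \<in> I. mps_var y)) M"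
    proof (cases "size M \<ge> 2")
      case True
      hence "M \<noteq> {#}" "M \<noteq> {#y#}" for y by auto
      thus ?thesis using F2[OF True]
        by (simp add: coeff_change_variables mps_rep_eqs coeff_sum coeff_var)
    next
      case False
      then consider "M = {#}" | j where "M = {#j#}"
        by (cases M) (auto, metis Suc_le_mono le_zero_eq not_less_eq_eq numeral_2_eq_2 size_eq_0_iff_empty)
      thus ?thesis
      proof cases
        case 1
        thus ?thesis by (simp add: coeff_change_variables mps_rep_eqs coeff_sum coeff_var normalized)
      next
        case 2
        have "coeff (change_variables l F i) M = l j * A i j"
          by (simp add: 2 coeff_change_variables A_def)
        also have "\<dots> = (if adj i j then 1 else 0)" by (simp add: A_eq l_def)
        also have "\<dots> = coeff (1 + (\<Sum>y \<in> I. mps_var y)) M"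
          by (simp add: 2 mps_rep_eqs coeff_sum coeff_var I)
        finally show ?thesis .
      qed
    qed
  qed
  \<comment> \<open>Any vertex gives the bipartition: its neighbours, and its non-neighbours
    together with itself.\<close>
  obtain x0 :: 'i where True by blast
  define I2 where "I2 = {y. adj x0 y}"
  have N1: "I2 = {y. adj x y}" if "x \<in> - I2" for x
    using adj_cases[of x0 x] that by (auto simp: I2_def)
  have N2: "- I2 = {y. adj x y}" if "x \<in> I2" for x
  proof (intro equalityI subsetI CollectI)
    fix y assume "y \<in> - I2"
    hence "adj y x" using N1[of y] that by blast
    thus "adj x y" by (simp add: adj_sym)
  next
    fix y assume "y \<in> {y. adj x y}"
    thus "y \<in> - I2" using no_triangle[of x0 y x] that by (auto simp: I2_def)
  qed
  have "I2 \<noteq> {}" using ex_adj[of x0] by (auto simp: I2_def)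
  moreover have "x0 \<in> - I2" by (simp add: I2_def)
  hence "- I2 \<noteq> {}" by blast
  moreover have "l j \<noteq> 0" for j by (simp add: l_def)
  moreover have "\<forall>x \<in> - I2. change_variables l F x = 1 + (\<Sum>y \<in> I2. mps_var y)"
    using eq N1 by blast
  moreover have "\<forall>x \<in> I2. change_variables l F x = 1 + (\<Sum>y \<in> - I2. mps_var y)"
    using eq N2 by blast
  ultimately show ?thesis
    unfolding two_multicyclic_def
    by (intro exI[of _ "- I2"] exI[of _ I2] exI[of _ l]) auto
qed

text \<open>In the corolla recurrence \<open>L i (Suc (size M)) j\<close> counts \<open>b j\<close>
  once per vertex, and each leaf adjacent to \<open>j\<close> takes one \<open>b j\<close> away; the
  root and the leaves not adjacent to \<open>j\<close> remain.\<close>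

lemma coeff_recurrence:
  assumes "\<And>i. \<beta> i = 2"
  defines "f \<equiv> change_variables (\<lambda>j. inverse (b j)) F"
  shows "adj i j \<Longrightarrow> of_nat (count M j + 1) * coeff (f i) (add_mset j M)
      = of_nat (1 + size {#m \<in># M. \<not> adj m j#}) * coeff (f i) M"
    and "\<not> adj i j \<Longrightarrow> coeff (f i) (add_mset j M) = 0"
proof -
  have f: "coeff (f i) M = (\<Prod>j \<in># M. inverse (b j)) * coeff (F i) M" for M
    by (simp add: f_def coeff_change_variables)
  have fact: "of_nat (mset_fact M) \<noteq> (0 :: 'k)" for M :: "'i multiset"
    using mset_fact_pos[of M] by simp
  {
    assume ij: "adj i j"
    have "(\<Sum>m \<in># M. A m j) = of_nat (size {#m \<in># M. adj m j#}) * b j"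
      by (induction M) (auto simp: A_eq algebra_simps)
    moreover have "size M = size {#m \<in># M. adj m j#} + size {#m \<in># M. \<not> adj m j#}"
      by (metis multiset_partition size_union)
    ultimately have "d i (add_mset j M) = d i M * (b j * of_nat (1 + size {#m \<in># M. \<not> adj m j#}))"
      by (simp add: d_add_mset L_of_beta_2[OF ij assms(1)] algebra_simps)
    moreover have "d i (add_mset j M) = of_nat (mset_fact M) * (of_nat (count M j + 1) * coeff (F i) (add_mset j M))"
      unfolding coeff_F[symmetric] mset_fact_add_mset of_nat_mult by (simp only: mult_ac)
    moreover have "d i M * (b j * of_nat (1 + size {#m \<in># M. \<not> adj m j#}))
        = of_nat (mset_fact M) * (coeff (F i) M * (b j * of_nat (1 + size {#m \<in># M. \<not> adj m j#})))"
      unfolding coeff_F[symmetric] by (simp only: mult_ac)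
    ultimately have "of_nat (mset_fact M) * (of_nat (count M j + 1) * coeff (F i) (add_mset j M))
        = of_nat (mset_fact M) * (coeff (F i) M * (b j * of_nat (1 + size {#m \<in># M. \<not> adj m j#})))"
      by (simp only:)
    hence "of_nat (count M j + 1) * coeff (F i) (add_mset j M)
        = coeff (F i) M * (b j * of_nat (1 + size {#m \<in># M. \<not> adj m j#}))"
      using fact mult_left_cancel by blast
    hence "(\<Prod>j \<in># M. inverse (b j)) * inverse (b j) * (of_nat (count M j + 1) * coeff (F i) (add_mset j M))
        = (\<Prod>j \<in># M. inverse (b j)) * inverse (b j) *
          (coeff (F i) M * (b j * of_nat (1 + size {#m \<in># M. \<not> adj m j#})))" by (rule arg_cong)
    thus "of_nat (count M j + 1) * coeff (f i) (add_mset j M)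
        = of_nat (1 + size {#m \<in># M. \<not> adj m j#}) * coeff (f i) M"
      unfolding f by (simp add: field_simps)
  next
    assume "\<not> adj i j"
    hence "of_nat (mset_fact (add_mset j M)) * coeff (F i) (add_mset j M) = 0"
      unfolding coeff_F by (rule d_not_adj) simp
    hence "coeff (F i) (add_mset j M) = 0" using fact[of "add_mset j M"] by (metis mult_eq_0_iff)
    thus "coeff (f i) (add_mset j M) = 0" by (simp add: f)
  }
qed

lemma quasi_complete_if_beta_2:
  assumes beta: "\<And>i. \<beta> i = 2"
  shows "quasi_complete F"
proof -
  define l where "l j = inverse (b j)" for j
  \<comment> \<open>By \<open>adj_cases\<close> non-adjacency is an equivalence relation; its
    classes are the parts of the partition.\<close>
  define cls where "cls x = {y. \<not> adj x y}" for x
  have cls_self: "x \<in> cls x" for x by (simp add: cls_def)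
  have cls_eq: "cls y = cls x" if "y \<in> cls x" for x y
    using adj_cases[of x y] that by (auto simp: cls_def)
  have "\<exists>P. bij_betw P {1..card (range cls)} (range cls)"
    by (rule ex_bij_betw_nat_finite_1) simp
  then obtain P where P: "bij_betw P {1..card (range cls)} (range cls)" by (rule exE)
  let ?M = "card (range cls)"
  have P_range: "\<exists>y. P p = cls y" if "p \<in> {1..?M}" for p
    using bij_betwE[OF P] that by (auto simp: image_iff)
  have P_cls: "P p = cls x" if p: "p \<in> {1..?M}" and x: "x \<in> P p" for p x
  proof -
    obtain y where "P p = cls y" using P_range[OF p] by (rule exE)
    thus ?thesis using cls_eq[of x y] x by simp
  qed
  have P_inj: "p = q" if "P p = P q" "p \<in> {1..?M}" "q \<in> {1..?M}" for p q
    using bij_betw_imp_inj_on[OF P] that by (rule inj_onD)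
  have P_disj: "P p \<inter> P q = {}" if "p \<in> {1..?M}" "q \<in> {1..?M}" "p \<noteq> q" for p q
  proof (rule ccontr)
    assume "P p \<inter> P q \<noteq> {}"
    then obtain x where "x \<in> P p" "x \<in> P q" by blast
    hence "P p = P q" using P_cls[OF that(1), of x] P_cls[OF that(2), of x] by simp
    hence "p = q" using that(1,2) by (rule P_inj)
    with that(3) show False by (rule notE)
  qed
  have P_ex: "\<exists>p \<in> {1..?M}. x \<in> P p" for x
  proof -
    have "cls x \<in> P ` {1..?M}" using bij_betw_imp_surj_on[OF P] by simp
    then obtain p where "p \<in> {1..?M}" "cls x = P p" by (rule imageE)
    thus ?thesis using cls_self[of x] by auto
  qed
  have eq: "change_variables l F x = (\<Prod>j \<in> {1..?M} - {p}. geometric (P j))"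
    if p: "p \<in> {1..?M}" and x: "x \<in> P p" for p x
  proof (rule mps_eqI)
    let ?f = "change_variables l F x" and ?Q = "\<Prod>j \<in> {1..?M} - {p}. geometric (P j) :: ('i, 'k) mps"
    fix K
    show "coeff ?f K = coeff ?Q K"
    \<comment> \<open>Both series have constant term 1 and satisfy the same recurrence.\<close>
    proof (induction K)
      case empty
      have "coeff (\<Prod>j \<in> T. geometric (P j) :: ('i, 'k) mps) {#} = 1" for T
        by (induction T rule: infinite_finite_induct) (simp_all add: coeff_geometric_empty one_mps.rep_eq)
      thus ?case by (simp add: coeff_change_variables normalized)
    next
      case (add j K)
      show ?case
      proof (cases "adj x j")
        case True
        obtain q where q: "q \<in> {1..?M}" "j \<in> P q" using P_ex by blast
        have "P q = cls j" by (rule P_cls[OF q])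
        \<comment> \<open>The part containing \<open>j\<close> consists of the vertices not adjacent
          to \<open>j\<close>, so the two recurrences have the same factor.\<close>
        hence P_q: "m \<in> P q \<longleftrightarrow> \<not> adj m j" for m by (simp add: cls_def adj_sym)
        have "q \<noteq> p" using P_q[of x] True x by auto
        hence "of_nat (count K j + 1) * coeff ?Q (add_mset j K) = of_nat (1 + size {#m \<in># K. m \<in> P q#}) * coeff ?Q K"
          using q P_disj by (intro coeff_prod_geometric) auto
        moreover have "of_nat (count K j + 1) * coeff ?f (add_mset j K) = of_nat (1 + size {#m \<in># K. m \<in> P q#}) * coeff ?f K"
          unfolding P_q l_def by (rule coeff_recurrence(1)[OF beta True])
        ultimately have "of_nat (count K j + 1) * coeff ?f (add_mset j K) = of_nat (count K j + 1) * coeff ?Q (add_mset j K)"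
          using add by simp
        moreover have "of_nat (count K j + 1) \<noteq> (0 :: 'k)" by (metis of_nat_eq_0_iff add_is_0 one_neq_zero)
        ultimately show ?thesis using mult_left_cancel by blast
      next
        case False
        \<comment> \<open>The variable \<open>h\<^sub>j\<close> belongs to the omitted factor, so
          neither side contains it.\<close>
        hence "j \<in> P p" using P_cls[OF p x] by (simp add: cls_def)
        hence "mps_deriv j ?Q = 0"
          using P_disj[OF p] by (intro mps_deriv_prod_0) (auto simp: mps_deriv_geometric)
        hence "coeff (mps_deriv j ?Q) K = 0" by (simp add: zero_mps.rep_eq)
        hence "of_nat (count K j + 1) * coeff ?Q (add_mset j K) = 0" by (simp only: coeff_deriv)
        hence "coeff ?Q (add_mset j K) = 0" by (metis mult_eq_0_iff of_nat_eq_0_iff add_is_0 one_neq_zero)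
        thus ?thesis using coeff_recurrence(2)[OF beta False, of K] by (simp add: l_def)
      qed
    qed
  qed
  have "2 \<le> ?M"
  proof -
    \<comment> \<open>The two ends of an edge lie in different classes.\<close>
    obtain x y where "adj x y" using ex_adj[of undefined] by (rule exE)
    hence "y \<notin> cls x" by (simp add: cls_def)
    hence "cls x \<noteq> cls y" using cls_self[of y] by metis
    hence "card {cls x, cls y} = 2" by simp
    moreover have "card {cls x, cls y} \<le> ?M" by (rule card_mono) auto
    ultimately show ?thesis by simp
  qed
  moreover have "P p \<noteq> {}" if "p \<in> {1..?M}" for p
    using P_range[OF that] cls_self by auto
  moreover have "disjoint_family_on P {1..?M}"
    unfolding disjoint_family_on_def using P_disj by blast
  moreover have "(\<Union>p \<in> {1..?M}. P p) = UNIV" using P_ex by blast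
  moreover have "l j \<noteq> 0" for j by (simp add: l_def)
  ultimately show ?thesis
    unfolding quasi_complete_def using eq[unfolded geometric_def]
    by (intro exI[of _ ?M] exI[of _ P] exI[of _ l]) blast
qed

end

theorem theorem40:
  fixes F :: "('i :: finite, 'k :: field_char_0) sdse"
  assumes nonconstant: "\<And>i c. F i \<noteq> mps_const c"
    and normalized: "\<And>i. coeff (F i) {#} = 1"
    and connected: "connected_sdse F"
    and symmetric: "symmetric_sdse F"
    and hopf: "hopf_sdse F"
  shows "two_multicyclic F \<or> quasi_complete F"
proof -
  interpret symmetric_hopf_sdse F
    using assms by unfold_locales
  from beta_dichotomy show ?thesis
    using two_multicyclic_if_beta_0 quasi_complete_if_beta_2 by blast
qed

end
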